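(* Let $V\subset V'\subset\mathbb{C}$ be open sets and let $f\in\mathcal{U}_{V,V'}$ with associated point $c=c(f)$. If $c$ does not belong to $AB(f)$, then $$\chi_-(f,c)=\liminf_{n\to\infty}\frac1n\log|Df^n(c)|\ge 0.$$
   Context: For open sets $V\subset V'\subset\mathbb{C}$, $\mathcal{U}_{V,V'}$ is the set of holomorphic maps $f:V\to V'$ for which there exist a unique point $c=c(f)\in V'$ and a number $\rho=\rho(f)>0$ such that: (U1) $f:V\setminus f^{-1}(c)\to V'\setminus\{c\}$ is an unbranched covering map; (U2) for each $n=0,1,2,\dots$ the iterate $f^n(c)$ is well defined and $B(f^n(c),\rho)\subset V'$. $AB(f)$ denotes the union of the basins of all attracting cycles of $f$ (empty if there are none). $B(w,r)$ is the open Euclidean disk. *)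

theory Defs
  imports "HOL-Analysis.Analysis"
begin

definition U_point :: "complex set \<Rightarrow> complex set \<Rightarrow> (complex \<Rightarrow> complex) \<Rightarrow> complex \<Rightarrow> bool" where
  "U_point V V' f c \<longleftrightarrow> c \<in> V' \<and>
     (\<exists>\<rho>>0.
        covering_space (V - {z \<in> V. f z = c}) f (V' - {c}) \<and>
        (\<forall>n. (f ^^ n) c \<in> V \<and> ball ((f ^^ n) c) \<rho> \<subseteq> V'))"

definition U_class :: "complex set \<Rightarrow> complex set \<Rightarrow> (complex \<Rightarrow> complex) \<Rightarrow> bool" where
  "U_class V V' f \<longleftrightarrow> open V \<and> open V' \<and> V \<subseteq> V' \<and>
     f holomorphic_on V \<and> f ` V \<subseteq> V' \<and> (\<exists>!c. U_point V V' f c)"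

definition attracting_periodic :: "complex set \<Rightarrow> (complex \<Rightarrow> complex) \<Rightarrow> complex \<Rightarrow> nat \<Rightarrow> bool" where
  "attracting_periodic V f p m \<longleftrightarrow> m \<ge> 1 \<and> (\<forall>k. (f ^^ k) p \<in> V) \<and>
     (f ^^ m) p = p \<and> cmod (deriv (f ^^ m) p) < 1"

definition AB :: "complex set \<Rightarrow> (complex \<Rightarrow> complex) \<Rightarrow> complex set" where
  "AB V f = {z \<in> V. (\<forall>n. (f ^^ n) z \<in> V) \<and>
     (\<exists>p m. attracting_periodic V f p m \<and>
        (\<exists>j<m. (\<lambda>n. (f ^^ (n * m)) z) \<longlonglongrightarrow> (f ^^ j) p))}"

definition log_abs :: "complex \<Rightarrow> ereal" where
  "log_abs w = (if w = 0 then - \<infinity> else ereal (ln (cmod w)))"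

definition chi_minus :: "(complex \<Rightarrow> complex) \<Rightarrow> complex \<Rightarrow> ereal" where
  "chi_minus f c = liminf (\<lambda>n. ereal (1 / real n) * log_abs (deriv (f ^^ n) c))"

end

theory Submission
  imports Defs "HOL-Complex_Analysis.Riemann_Mapping"
begin

text \<open>
  Pull a disc around \<open>f\<^sup>n(c)\<close> back along the orbit of \<open>c\<close>, shrinking it slightly at each step.
  By the covering property the inverse branch is univalent until the pulled back disc contains \<open>c\<close>.
  At that moment \<open>f\<^sup>m\<close> maps a disc of radius about \<open>r / \<bar>Df\<^sup>m\<bar>\<close> around \<open>c\<close>, and around the
  current orbit point, univalently into the disc of radius \<open>r\<close> one started from; by Koebe distortion
  the error is polynomial in \<open>m\<close>. Restart with a disc around the current orbit point that avoids \<open>c\<close>.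

  The derivative can be small only if the discs grow, and three facts prevent that. If the starting
  disc touches \<open>c\<close>, a much larger disc around \<open>c\<close> would be mapped into itself, so \<open>c\<close> would be
  attracted to a cycle. In general, unless \<open>f\<close> is affine, \<open>f\<close> is not univalent on large discs around
  \<open>c\<close>, so a single growth is by a bounded factor, which a long return time absorbs. Growths with
  a bounded return time start in a bounded region; two of them starting close to each other
  would again give an attracting cycle, so their number is bounded.
  Hence \<open>\<bar>Df\<^sup>n(c)\<bar> \<ge> C exp (- 2 \<eta> n)\<close> for every \<open>\<eta> > 0\<close>.
\<close>

section \<open>Distortion of univalent functions\<close>

text \<open>Continuity up to the boundary circle is not assumed, so Cauchy's estimate is applied on
  circles of radius \<open>x < r\<close>, and \<open>x\<close> tends to \<open>r\<close>.\<close>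

lemma Cauchy_inequality_ball:
  assumes holf: "f holomorphic_on ball a r" and "0 < r"
    and bound: "\<And>z. z \<in> ball a r \<Longrightarrow> cmod (f z) \<le> B"
  shows "cmod ((deriv ^^ n) f a) \<le> fact n * B / r ^ n"
proof (rule tendsto_lowerbound)
  show "((\<lambda>x. fact n * B / x ^ n) \<longlongrightarrow> fact n * B / r ^ n) (at_left r)"
    using \<open>0 < r\<close> by (intro tendsto_intros) auto
  have "cmod ((deriv ^^ n) f a) \<le> fact n * B / x ^ n" if "0 < x" "x < r" for x
  proof (rule Cauchy_inequality)
    have "cball a x \<subseteq> ball a r"
      using that by auto
    then show "f holomorphic_on ball a x" "continuous_on (cball a x) f"
      using holf holomorphic_on_subset holomorphic_on_imp_continuous_on ball_subset_cball
      by (meson order_trans)+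
    show "cmod (f z) \<le> B" if "cmod (a - z) = x" for z
      using that \<open>x < r\<close> by (intro bound) (auto simp: dist_norm)
  qed (use that in auto)
  moreover have "\<forall>\<^sub>F x in at_left r. x \<in> {0<..<r}"
    using \<open>0 < r\<close> by (rule eventually_at_left_real)
  ultimately show "\<forall>\<^sub>F x in at_left r. cmod ((deriv ^^ n) f a) \<le> fact n * B / x ^ n"
    by (auto elim: eventually_mono)
qed auto

text \<open>
  If \<open>w\<close> is an omitted value closest to \<open>g a\<close>, the square root of \<open>1 - (g - g a) / (w - g a)\<close> and its
  negative have disjoint images, and the former covers \<open>ball 1 (1/4)\<close>, so the root stays away from \<open>- 1\<close>.
\<close>

lemma Koebe_quarter_weak:
  assumes holg: "g holomorphic_on ball a r" and inj: "inj_on g (ball a r)" and "0 < r"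
  shows "ball (g a) (r * cmod (deriv g a) / 32) \<subseteq> g ` ball a r"
proof (cases "g ` ball a r = UNIV")
  case False
  define W where "W = g ` ball a r"
  have "open W"
    unfolding W_def using holg inj open_mapping_thm3 open_ball by blast
  with False obtain w where w: "w \<notin> W" "\<And>y. y \<notin> W \<Longrightarrow> dist (g a) w \<le> dist (g a) y"
    using distance_attains_inf[of "-W" "g a"] unfolding W_def by (metis ComplD ComplI Compl_UNIV_eq closed_Compl double_complement)
  define d where "d = dist (g a) w"
  have aW: "g a \<in> W"
    using \<open>0 < r\<close> by (simp add: W_def)
  have "d > 0"
    using w(1) aW unfolding d_def by auto
  have ballW: "ball (g a) d \<subseteq> W"
    using w(2) unfolding d_def by force
  have wga: "w - g a \<noteq> 0"
    using w(1) aW by auto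
  define F where "F z = 1 - (g z - g a) / (w - g a)" for z
  have holF: "F holomorphic_on ball a r"
    unfolding F_def using holg wga by (intro holomorphic_intros) auto
  have F0: "F z \<noteq> 0" if "z \<in> ball a r" for z
  proof
    assume "F z = 0"
    then have "g z = w"
      using wga by (simp add: F_def field_simps)
    then show False
      using w(1) that by (auto simp: W_def)
  qed
  obtain h0 where h0: "h0 holomorphic_on ball a r" "\<And>z. z \<in> ball a r \<Longrightarrow> F z = h0 z ^ 2"
    using contractible_imp_holomorphic_sqrt[OF holF _ F0] convex_imp_contractible by blast
  have "h0 a ^ 2 = 1"
    using h0(2)[of a] \<open>0 < r\<close> by (simp add: F_def)
  define h where "h z = h0 z / h0 a" for z
  have h0a: "h0 a \<noteq> 0"
    using \<open>h0 a ^ 2 = 1\<close> by auto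
  have holh: "h holomorphic_on ball a r"
    unfolding h_def using h0 h0a by (intro holomorphic_intros) auto
  have h2: "F z = h z ^ 2" if "z \<in> ball a r" for z
    using h0(2)[OF that] \<open>h0 a ^ 2 = 1\<close> by (simp add: h_def power_divide)
  have ha: "h a = 1"
    using h0a by (simp add: h_def)
  have disj: "- h z \<notin> h ` ball a r" if z: "z \<in> ball a r" for z
  proof
    assume "- h z \<in> h ` ball a r"
    then obtain z' where z': "z' \<in> ball a r" "h z' = - h z"
      by auto
    then have "F z = F z'"
      using h2 z by auto
    then have "g z = g z'"
      using wga by (simp add: F_def)
    then have "z = z'"
      using inj z z' by (meson inj_onD)
    then have "h z = 0"
      using z'(2) by simp
    then show False
      using F0 h2 z by force
  qed
  define U where "U = h ` ball a r"
  have "inj_on h (ball a r)"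
  proof (rule inj_onI)
    fix x y assume "x \<in> ball a r" "y \<in> ball a r" "h x = h y"
    then have "F x = F y"
      using h2 by auto
    then have "g x = g y"
      using wga by (simp add: F_def)
    then show "x = y"
      using inj \<open>x \<in> ball a r\<close> \<open>y \<in> ball a r\<close> by (meson inj_onD)
  qed
  then have "open U"
    unfolding U_def using holh open_mapping_thm3 open_ball by blast
  have "uminus ` U = {v. - v \<in> U}"
    by (force simp: image_iff)
  then have "open {v. - v \<in> U}"
    using \<open>open U\<close> open_negations by metis
  have one: "(1::complex) \<in> U"
    using ha \<open>0 < r\<close> unfolding U_def by force
  \<comment> \<open>For such \<open>v\<close> the modulus of \<open>1 - v\<^sup>2\<close> is below
    1, so \<open>g\<close> attains the value at which \<open>F\<close> equals
    \<open>v\<^sup>2\<close>; hence \<open>v\<close> or \<open>- v\<close> is a value of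
    \<open>h\<close>.\<close>
  have cover: "v \<in> U \<or> - v \<in> U" if v: "v \<in> ball 1 (1/4)" for v
  proof -
    have "cmod (v + 1) \<le> cmod (v - 1) + 2"
      using norm_triangle_ineq[of "v - 1" 2] by (simp add: add.commute)
    moreover have v1: "cmod (v - 1) < 1/4"
      using v by (simp add: dist_norm norm_minus_commute)
    ultimately have "cmod (v - 1) * cmod (v + 1) \<le> (1/4) * (9/4)"
      by (intro mult_mono) auto
    then have "cmod (v\<^sup>2 - 1) < 1"
      by (simp flip: norm_mult add: power2_eq_square algebra_simps)
    then have "cmod (1 - v\<^sup>2) * d < d"
      using \<open>d > 0\<close> by (simp add: norm_minus_commute)
    then have "g a + (1 - v\<^sup>2) * (w - g a) \<in> ball (g a) d"
      by (simp add: dist_norm d_def norm_mult norm_minus_commute)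
    then obtain z where z: "z \<in> ball a r" "g z = g a + (1 - v\<^sup>2) * (w - g a)"
      using ballW unfolding W_def by (metis (no_types, lifting) imageE subsetD)
    then have "F z = v\<^sup>2"
      using wga by (simp add: F_def)
    then have "v = h z \<or> - v = h z"
      using h2[OF z(1)] by (metis minus_minus power2_eq_iff)
    then show ?thesis
      using z(1) unfolding U_def by (auto intro: rev_image_eqI)
  qed
  have "U \<inter> {v. - v \<in> U} \<inter> ball 1 (1/4) = {}"
    using disj unfolding U_def by blast
  \<comment> \<open>The disc is connected and covered by two open sets that are disjoint on it; as 1
    lies in \<open>U\<close>, the whole disc does.\<close>
  moreover have "ball 1 (1/4) \<subseteq> U \<union> {v. - v \<in> U}"
    using cover by blast
  ultimately have "U \<inter> ball 1 (1/4) = {} \<or> {v. - v \<in> U} \<inter> ball 1 (1/4) = {}"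
    using \<open>open U\<close> \<open>open {v. - v \<in> U}\<close> by (intro connectedD) auto
  moreover have "(1::complex) \<in> ball 1 (1/4)"
    by simp
  ultimately have sub: "ball 1 (1/4) \<subseteq> U"
    using one cover by blast
  have far: "cmod (h z + 1) \<ge> 1/4" if "z \<in> ball a r" for z
  proof (rule ccontr)
    assume "\<not> ?thesis"
    then have "dist 1 (- h z) < 1/4"
      by (simp add: dist_norm add.commute)
    then have "- h z \<in> U"
      using sub by auto
    then show False
      using disj[OF that] by (simp add: U_def)
  qed
  then have hp: "h z + 1 \<noteq> 0" if "z \<in> ball a r" for z
    using that by fastforce
  \<comment> \<open>\<open>k\<close> is bounded by 4, so its derivative at \<open>a\<close> is at
    most \<open>4 / r\<close>. This derivative is \<open>deriv g a / (8 * (w - g a))\<close>, which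
    explains the constant \<open>32 = 4 * 8\<close>.\<close>
  define k where "k z = 1 / (h z + 1)" for z
  have "k holomorphic_on ball a r"
    unfolding k_def using holh hp by (intro holomorphic_intros) auto
  moreover have "cmod (k z) \<le> 4" if "z \<in> ball a r" for z
    using far[OF that] hp[OF that] by (simp add: k_def norm_divide field_simps)
  ultimately have k': "cmod (deriv k a) \<le> 4 / r"
    using Cauchy_inequality_ball[of k a r 4 1] \<open>0 < r\<close> by simp
  have a: "a \<in> ball a r"
    using \<open>0 < r\<close> by simp
  have dg: "(g has_field_derivative deriv g a) (at a)" and dh: "(h has_field_derivative deriv h a) (at a)"
    using holg holh a holomorphic_derivI open_ball by blast+
  have dF: "(F has_field_derivative - deriv g a / (w - g a)) (at a)"
    unfolding F_def using wga by (auto intro!: derivative_eq_intros dg)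
  have "((\<lambda>z. h z ^ 2) has_field_derivative 2 * deriv h a) (at a)"
    using ha by (auto intro!: derivative_eq_intros dh)
  then have "(F has_field_derivative 2 * deriv h a) (at a)"
    by (rule has_field_derivative_transform_within_open[OF _ open_ball a]) (simp add: h2)
  then have h': "2 * deriv h a = - deriv g a / (w - g a)"
    using dF DERIV_unique by blast
  have "(k has_field_derivative - deriv h a / 4) (at a)"
    unfolding k_def using ha by (auto intro!: derivative_eq_intros dh)
  then have "deriv k a = - deriv h a / 4"
    by (rule DERIV_imp_deriv)
  also have "- deriv h a / 4 = - (2 * deriv h a) / 8"
    by simp
  also have "\<dots> = deriv g a / (8 * (w - g a))"
    unfolding h' by (simp add: mult.commute)
  finally have "deriv k a = deriv g a / (8 * (w - g a))" .
  then have "cmod (deriv g a) / (8 * d) \<le> 4 / r"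
    using k' by (simp add: norm_divide norm_mult d_def dist_norm norm_minus_commute del: right_diff_distrib_numeral)
  then have "r * cmod (deriv g a) / 32 \<le> d"
    using \<open>d > 0\<close> \<open>0 < r\<close> by (simp add: field_simps)
  then show ?thesis
    using ballW unfolding W_def by (meson order_trans subset_ball)
qed auto

text \<open>Cauchy's estimate bounds the second derivative of the inverse \<open>G\<close> by
  \<open>2 * r / s ^ 2\<close> on the disc of radius \<open>s = r * cmod D / 32\<close>.
  Differentiating \<open>deriv g z * deriv G (g z) = 1\<close> transfers this to \<open>g\<close>,
  and \<open>2 * 32 ^ 2 = 2048\<close>.\<close>

lemma univalent_deriv2_bound:
  assumes holg: "g holomorphic_on ball a r" and inj: "inj_on g (ball a r)" and "0 < r"
  shows "cmod (deriv (deriv g) a) \<le> 2048 * cmod (deriv g a) / r"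
proof -
  obtain G where G: "G holomorphic_on (g ` ball a r)"
    "\<And>z. z \<in> ball a r \<Longrightarrow> deriv g z * deriv G (g z) = 1" "\<And>z. z \<in> ball a r \<Longrightarrow> G (g z) = z"
    using holomorphic_has_inverse[OF holg open_ball inj] by metis
  define W where "W = g ` ball a r"
  have "open W"
    unfolding W_def using holg inj open_mapping_thm3 open_ball by blast
  have a: "a \<in> ball a r"
    using \<open>0 < r\<close> by simp
  define D where "D = deriv g a"
  have "D \<noteq> 0"
    using G(2)[OF a] by (auto simp: D_def)
  define s where "s = r * cmod D / 32"
  have "s > 0"
    using \<open>0 < r\<close> \<open>D \<noteq> 0\<close> by (simp add: s_def)
  have sub: "ball (g a) s \<subseteq> W"
    unfolding W_def s_def D_def by (rule Koebe_quarter_weak[OF assms])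
  have "cmod ((deriv ^^ 2) (\<lambda>z. G z - a) (g a)) \<le> fact 2 * r / s ^ 2"
  proof (rule Cauchy_inequality_ball)
    show "(\<lambda>z. G z - a) holomorphic_on ball (g a) s"
      using G(1) sub unfolding W_def by (intro holomorphic_intros) (auto intro: holomorphic_on_subset)
    fix z assume "z \<in> ball (g a) s"
    then obtain y where "y \<in> ball a r" "z = g y"
      using sub unfolding W_def by blast
    then show "cmod (G z - a) \<le> r"
      using G(3) by (simp add: dist_norm norm_minus_commute)
  qed fact
  moreover have "(deriv ^^ 2) (\<lambda>z. G z - a) (g a) = deriv (deriv G) (g a)"
  proof -
    have "deriv (\<lambda>z. G z - a) z = deriv G z" if "z \<in> W" for z
      by (rule DERIV_imp_deriv)
        (use G(1) that \<open>open W\<close> W_def in \<open>auto intro!: derivative_eq_intros holomorphic_derivI\<close>)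
    moreover have "g a \<in> W"
      using a by (simp add: W_def)
    moreover have "eventually (\<lambda>z. z \<in> W) (nhds (g a))"
      using \<open>open W\<close> \<open>g a \<in> W\<close> by (rule eventually_nhds_in_open)
    ultimately show ?thesis
      by (simp add: numeral_2_eq_2 del: deriv_diff) (rule deriv_cong_ev; auto elim!: eventually_mono)
  qed
  ultimately have G2: "cmod (deriv (deriv G) (g a)) \<le> 2 * r / s ^ 2"
    by simp
  have dg: "(g has_field_derivative D) (at a)"
    unfolding D_def using holg a holomorphic_derivI open_ball by blast
  have ddg: "(deriv g has_field_derivative deriv (deriv g) a) (at a)"
    using holg a holomorphic_derivI holomorphic_deriv open_ball by blast
  have "(deriv G has_field_derivative deriv (deriv G) (g a)) (at (g a))"
    using G(1) a \<open>open W\<close> W_def holomorphic_derivI holomorphic_deriv by blast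
  then have ddG: "((\<lambda>z. deriv G (g z)) has_field_derivative deriv (deriv G) (g a) * D) (at a)"
    using dg DERIV_chain2 by blast
  have "((\<lambda>z. deriv g z * deriv G (g z)) has_field_derivative
      deriv (deriv g) a * deriv G (g a) + deriv (deriv G) (g a) * D * deriv g a) (at a)"
    by (rule DERIV_mult[OF ddg ddG])
  moreover have "((\<lambda>z. deriv g z * deriv G (g z)) has_field_derivative 0) (at a)"
    by (rule has_field_derivative_transform_within_open[OF DERIV_const[of 1] open_ball a]) (simp add: G(2))
  ultimately have eq: "deriv (deriv g) a * deriv G (g a) + deriv (deriv G) (g a) * D * D = 0"
    using DERIV_unique unfolding D_def by blast
  have "deriv (deriv g) a = deriv (deriv g) a * deriv G (g a) * D"
    using G(2)[OF a] by (simp add: D_def mult.commute mult.left_commute)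
  also have "\<dots> = - deriv (deriv G) (g a) * D ^ 3"
  proof -
    have "deriv (deriv g) a * deriv G (g a) = - (deriv (deriv G) (g a) * D * D)"
      using eq by (simp add: eq_neg_iff_add_eq_0)
    then show ?thesis
      by (simp add: power3_eq_cube)
  qed
  finally have "cmod (deriv (deriv g) a) = cmod (deriv (deriv G) (g a)) * cmod D ^ 3"
    by (simp add: norm_mult norm_power)
  also have "\<dots> \<le> 2 * r / s ^ 2 * cmod D ^ 3"
    using G2 by (intro mult_right_mono) auto
  also have "\<dots> = 2048 * cmod D / r"
    using \<open>0 < r\<close> \<open>D \<noteq> 0\<close> by (simp add: s_def field_simps power2_eq_square power3_eq_cube)
  finally show ?thesis
    by (simp add: D_def)
qed

text \<open>For a logarithm \<open>h\<close> of \<open>deriv g\<close>, the derivative of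
  \<open>h\<close> is the quotient of the second and the first derivative of \<open>g\<close>. The
  previous bound on \<open>ball z (r - dist a z)\<close> gives modulus at most
  \<open>2048 / (r - dist a z)\<close>, which is integrated along the segment from \<open>a\<close>
  to \<open>w\<close>.\<close>

lemma univalent_log_deriv:
  assumes holg: "g holomorphic_on ball a r" and inj: "inj_on g (ball a r)" and w: "w \<in> ball a r"
  shows "\<bar>ln (cmod (deriv g w)) - ln (cmod (deriv g a))\<bar> \<le> 2048 * ln (r / (r - dist a w))"
proof -
  have "0 < r"
    using w zero_le_dist[of a w] by (simp del: zero_le_dist)
  have nz: "deriv g z \<noteq> 0" if "z \<in> ball a r" for z
    using holomorphic_injective_imp_regular[OF holg open_ball inj that] .
  have holg': "deriv g holomorphic_on ball a r"
    using holg holomorphic_deriv open_ball by blast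
  obtain h where h: "h holomorphic_on ball a r" "\<And>z. z \<in> ball a r \<Longrightarrow> deriv g z = exp (h z)"
    using contractible_imp_holomorphic_log[OF holg' _ nz] convex_imp_contractible convex_ball by blast
  have hRe: "ln (cmod (deriv g z)) = Re (h z)" if "z \<in> ball a r" for z
    using h(2)[OF that] by simp
  have h': "cmod (deriv h z) \<le> 2048 / (r - dist a z)" if z: "z \<in> ball a r" for z
  proof -
    define s where "s = r - dist a z"
    have s: "s > 0"
      using z by (simp add: s_def)
    have sub: "ball z s \<subseteq> ball a r"
    proof
      fix y assume "y \<in> ball z s"
      then show "y \<in> ball a r"
        using dist_triangle[of a y z] by (simp add: s_def)
    qed
    have "cmod (deriv (deriv g) z) \<le> 2048 * cmod (deriv g z) / s"
      using holg inj sub s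
      by (intro univalent_deriv2_bound) (auto intro: holomorphic_on_subset inj_on_subset)
    moreover have "((\<lambda>x. exp (h x)) has_field_derivative exp (h z) * deriv h z) (at z)"
      using holomorphic_derivI[OF h(1) open_ball z] by (auto intro!: derivative_eq_intros)
    then have "(deriv g has_field_derivative exp (h z) * deriv h z) (at z)"
      by (rule has_field_derivative_transform_within_open[OF _ open_ball z]) (simp add: h(2))
    then have "deriv (deriv g) z = deriv g z * deriv h z"
      using h(2)[OF z] by (simp add: DERIV_imp_deriv)
    ultimately have "cmod (deriv g z) * cmod (deriv h z) \<le> cmod (deriv g z) * (2048 / s)"
      by (simp add: norm_mult mult.commute)
    then show ?thesis
      using nz[OF z] unfolding s_def by (subst (asm) mult_le_cancel_left_pos) auto
  qed
  define p where "p x = a + of_real x * (w - a)" for x :: real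
  define l where "l = dist a w"
  have l: "0 \<le> l" "l < r"
    using w by (auto simp: l_def)
  have pin: "p x \<in> ball a r" and dp: "dist a (p x) = x * l" if "0 \<le> x" "x \<le> 1" for x
  proof -
    show "dist a (p x) = x * l"
      using that by (simp add: p_def dist_norm l_def norm_mult norm_minus_commute)
    moreover have "x * l \<le> l"
      using that l by (simp add: mult_left_le_one_le)
    ultimately show "p x \<in> ball a r"
      using l by simp
  qed
  have dRe: "((\<lambda>x. Re (h (p x))) has_real_derivative Re (deriv h (p x) * (w - a))) (at x)"
    if "0 \<le> x" "x \<le> 1" for x
  proof -
    have "(p has_vector_derivative (w - a)) (at x)"
      unfolding p_def by (auto intro!: derivative_eq_intros simp: has_vector_derivative_def scaleR_conv_of_real)
    moreover have "(h has_field_derivative deriv h (p x)) (at (p x))"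
      using holomorphic_derivI[OF h(1) open_ball pin[OF that]] .
    ultimately have "(h \<circ> p has_vector_derivative (w - a) * deriv h (p x)) (at x)"
      by (rule field_vector_diff_chain_at)
    from bounded_linear.has_vector_derivative[OF bounded_linear_Re this] show ?thesis
      by (simp add: o_def mult.commute has_real_derivative_iff_has_vector_derivative del: Re_complex_of_real times_complex.sel)
  qed
  have dl: "((\<lambda>x. - ln (r - x * l)) has_real_derivative l / (r - x * l)) (at x)" if "0 \<le> x" "x \<le> 1" for x
  proof -
    have "x * l < r"
      using pin[OF that] dp[OF that] by simp
    then show ?thesis
      by (auto intro!: derivative_eq_intros)
  qed
  have bd: "\<bar>Re (deriv h (p x) * (w - a))\<bar> \<le> 2048 * (l / (r - x * l))" if "0 \<le> x" "x \<le> 1" for x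
  proof -
    have "\<bar>Re (deriv h (p x) * (w - a))\<bar> \<le> cmod (deriv h (p x) * (w - a))"
      by (rule abs_Re_le_cmod)
    also have "\<dots> = cmod (deriv h (p x)) * l"
      by (simp add: norm_mult l_def dist_norm norm_minus_commute)
    also have "\<dots> \<le> 2048 / (r - x * l) * l"
      using h'[OF pin[OF that]] dp[OF that] l by (intro mult_right_mono) auto
    finally show ?thesis
      by simp
  qed
  \<comment> \<open>Instead of an integral, monotonicity: \<open>- 2048 * ln (r - x * l)\<close>
    grows at least as fast as both \<open>Re (h (p x))\<close> and its negative decrease.\<close>
  have "Re (h (p 0)) + 2048 * (- ln (r - 0 * l)) \<le> Re (h (p 1)) + 2048 * (- ln (r - 1 * l))"
  proof (rule DERIV_nonneg_imp_nondecreasing[where f = "\<lambda>x. Re (h (p x)) + 2048 * (- ln (r - x * l))"])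
    fix x :: real assume x: "0 \<le> x" "x \<le> 1"
    show "\<exists>y. ((\<lambda>x. Re (h (p x)) + 2048 * (- ln (r - x * l))) has_real_derivative y) (at x) \<and> 0 \<le> y"
    proof (intro exI[of _ "Re (deriv h (p x) * (w - a)) + 2048 * (l / (r - x * l))"] conjI)
      show "((\<lambda>x. Re (h (p x)) + 2048 * (- ln (r - x * l))) has_real_derivative
          Re (deriv h (p x) * (w - a)) + 2048 * (l / (r - x * l))) (at x)"
        by (rule DERIV_add[OF dRe[OF x] DERIV_cmult[OF dl[OF x]]])
    qed (use bd[OF x] in linarith)
  qed simp
  moreover have "- Re (h (p 0)) + 2048 * (- ln (r - 0 * l)) \<le> - Re (h (p 1)) + 2048 * (- ln (r - 1 * l))"
  proof (rule DERIV_nonneg_imp_nondecreasing[where f = "\<lambda>x. - Re (h (p x)) + 2048 * (- ln (r - x * l))"])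
    fix x :: real assume x: "0 \<le> x" "x \<le> 1"
    show "\<exists>y. ((\<lambda>x. - Re (h (p x)) + 2048 * (- ln (r - x * l))) has_real_derivative y) (at x) \<and> 0 \<le> y"
    proof (intro exI[of _ "- Re (deriv h (p x) * (w - a)) + 2048 * (l / (r - x * l))"] conjI)
      show "((\<lambda>x. - Re (h (p x)) + 2048 * (- ln (r - x * l))) has_real_derivative
          - Re (deriv h (p x) * (w - a)) + 2048 * (l / (r - x * l))) (at x)"
        by (rule DERIV_add[OF DERIV_minus[OF dRe[OF x]] DERIV_cmult[OF dl[OF x]]])
    qed (use bd[OF x] in linarith)
  qed simp
  moreover have "p 0 = a" "p 1 = w"
    by (auto simp: p_def)
  moreover have "ln (r / (r - l)) = ln r - ln (r - l)"
    using l \<open>0 < r\<close> by (simp add: ln_div)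
  ultimately show ?thesis
    using hRe[OF w] hRe[of a] \<open>0 < r\<close> by (simp add: l_def)
qed

section \<open>Self-maps of discs\<close>

text \<open>Brouwer gives a fixed point, a Moebius map moves it to 0, and the image of the
  conjugated map lies in a disc of radius \<open>k < 1\<close>. The Schwarz lemma then makes the
  conjugated map contract towards 0 by the factor \<open>k\<close>.\<close>

lemma unit_disc_self_map_attracting:
  assumes holF: "F holomorphic_on ball 0 1" and q: "q < 1"
    and FD: "\<And>z. cmod z < 1 \<Longrightarrow> cmod (F z) \<le> q"
  obtains p where "cmod p < 1" "F p = p" "cmod (deriv F p) < 1"
    "\<And>z. cmod z < 1 \<Longrightarrow> (\<lambda>n. (F ^^ n) z) \<longlonglongrightarrow> p"
proof -
  have F1: "cmod (F z) < 1" if "cmod z < 1" for z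
    using FD[OF that] q by linarith
  have "0 \<le> q"
    using FD[of 0] norm_ge_zero[of "F 0"] by (simp del: norm_ge_zero)
  define q' where "q' = (q + 1) / 2"
  have q': "q < q'" "0 < q'" "q' < 1"
    using q \<open>0 \<le> q\<close> by (auto simp: q'_def)
  have sub: "cball 0 q' \<subseteq> ball (0::complex) 1"
    using q' by auto
  obtain p where p: "p \<in> cball 0 q'" "F p = p"
  proof (rule brouwer_ball[of q' 0 F])
    show "continuous_on (cball 0 q') F"
      using holF sub holomorphic_on_imp_continuous_on continuous_on_subset by blast
    show "F \<in> cball 0 q' \<rightarrow> cball 0 q'"
    proof
      fix z :: complex assume "z \<in> cball 0 q'"
      then have "cmod (F z) \<le> q"
        using q' by (intro FD) auto
      then show "F z \<in> cball 0 q'"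
        using q' by simp
    qed
  qed (use q' in auto)
  have p1: "cmod p < 1"
    using p(1) q' by simp
  define \<psi> \<phi> where "\<psi> = Moebius_function 0 p" and "\<phi> = Moebius_function 0 (-p)"
  have hol: "\<psi> holomorphic_on ball 0 1" "\<phi> holomorphic_on ball 0 1"
    using p1 by (auto simp: \<psi>_def \<phi>_def intro: Moebius_function_holomorphic)
  have lt1: "cmod (\<psi> z) < 1" "cmod (\<phi> z) < 1" if "cmod z < 1" for z
    using p1 that by (auto simp: \<psi>_def \<phi>_def intro: Moebius_function_norm_lt_1)
  have inv: "\<psi> (\<phi> z) = z" "\<phi> (\<psi> z) = z" if "cmod z < 1" for z
    using p1 that by (auto simp: \<psi>_def \<phi>_def intro!: Moebius_function_compose)
  have vals: "\<psi> p = 0" "\<phi> 0 = p"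
    by (auto simp: \<psi>_def \<phi>_def Moebius_function_eq_zero Moebius_function_of_zero)
  obtain k where k: "0 < k" "k < 1" "\<And>z. z \<in> cball 0 q' \<Longrightarrow> cmod (\<psi> z) < k"
  proof -
    have "continuous_on (cball 0 q') (\<lambda>z. cmod (\<psi> z))"
      using hol(1) sub by (intro continuous_on_norm) (meson continuous_on_subset holomorphic_on_imp_continuous_on)
    then obtain x where x: "x \<in> cball 0 q'" "\<And>z. z \<in> cball 0 q' \<Longrightarrow> cmod (\<psi> z) \<le> cmod (\<psi> x)"
      using continuous_attains_sup[of "cball 0 q'" "\<lambda>z. cmod (\<psi> z)"] q' by auto
    have "cmod (\<psi> x) < 1"
      using x(1) sub lt1 by auto
    then obtain k where "cmod (\<psi> x) < k" "k < 1"
      using dense by blast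
    then show ?thesis
      using that[of k] x(2) by (meson norm_ge_zero order_le_less_trans)
  qed
  \<comment> \<open>After division by \<open>k\<close> this is still a self-map of the unit disc, so
    the Schwarz lemma gains the factor \<open>k\<close> for the map itself.\<close>
  define G where "G z = \<psi> (F (\<phi> z)) / k" for z
  have img: "F ` \<phi> ` ball 0 1 \<subseteq> ball 0 1" "\<phi> ` ball 0 1 \<subseteq> ball 0 1"
    using lt1 F1 by auto
  have "F \<circ> \<phi> holomorphic_on ball 0 1"
    using hol(2) holF img(2) by (rule holomorphic_on_compose_gen)
  then have "\<psi> \<circ> (F \<circ> \<phi>) holomorphic_on ball 0 1"
    by (rule holomorphic_on_compose_gen[OF _ hol(1)]) (use img(1) in \<open>simp add: image_comp o_def\<close>)
  then have holG: "G holomorphic_on ball 0 1"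
    unfolding G_def o_def using k by (intro holomorphic_intros) auto
  have G0: "G 0 = 0"
    using vals p(2) by (simp add: G_def)
  have G1: "cmod (G z) < 1" if "cmod z < 1" for z
  proof -
    have "cmod (F (\<phi> z)) \<le> q"
      using FD lt1 that by blast
    then have "cmod (\<psi> (F (\<phi> z))) < k"
      using q' by (intro k(3)) auto
    then show ?thesis
      using k by (simp add: G_def norm_divide)
  qed
  have Sch: "cmod (G z) \<le> cmod z" if "cmod z < 1" for z
    using Schwarz_Lemma(1)[OF holG G0 G1 that] .
  have Sch': "cmod (deriv G 0) \<le> 1"
    using Schwarz_Lemma(2)[OF holG G0 G1, of 0] by simp
  define H where "H z = k * G z" for z
  have HF: "H (\<psi> z) = \<psi> (F z)" if "cmod z < 1" for z
    using inv(2)[OF that] k by (simp add: H_def G_def)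
  have Hle: "cmod (H z) \<le> k * cmod z" if "cmod z < 1" for z
    using Sch[OF that] k by (simp add: H_def norm_mult)
  have iter: "cmod ((F ^^ n) z) < 1 \<and> \<psi> ((F ^^ n) z) = (H ^^ n) (\<psi> z)
      \<and> cmod ((H ^^ n) (\<psi> z)) \<le> k ^ n" if z: "cmod z < 1" for n z
  proof (induction n)
    case 0
    then show ?case using z lt1[OF z] by simp
  next
    case (Suc n)
    then have "cmod ((H ^^ n) (\<psi> z)) < 1"
      using lt1 by metis
    then have "cmod (H ((H ^^ n) (\<psi> z))) \<le> k * k ^ n"
      using Hle Suc k by (meson mult_left_mono less_imp_le order_trans)
    then show ?case
      using Suc F1 HF[of "(F ^^ n) z"] by simp
  qed
  have conv: "(\<lambda>n. (F ^^ n) z) \<longlonglongrightarrow> p" if z: "cmod z < 1" for z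
  proof -
    have lim: "(\<lambda>n. k ^ n) \<longlonglongrightarrow> 0"
      using k by (intro LIMSEQ_realpow_zero) auto
    have "\<forall>\<^sub>F n in sequentially. cmod ((H ^^ n) (\<psi> z)) \<le> k ^ n"
      using iter[OF z] by (intro always_eventually allI) blast
    from Lim_null_comparison[OF this lim] have "(\<lambda>n. (H ^^ n) (\<psi> z)) \<longlonglongrightarrow> 0" .
    moreover have "isCont \<phi> 0"
      using hol(2) by (meson centre_in_ball continuous_on_eq_continuous_at holomorphic_on_imp_continuous_on open_ball zero_less_one)
    ultimately have "(\<lambda>n. \<phi> ((H ^^ n) (\<psi> z))) \<longlonglongrightarrow> \<phi> 0"
      by (rule isCont_tendsto_compose[rotated])
    moreover have "\<phi> ((H ^^ n) (\<psi> z)) = (F ^^ n) z" for n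
      using iter[OF z] inv(2) by metis
    ultimately show ?thesis
      using vals by simp
  qed
  have d\<psi>: "(\<psi> has_field_derivative deriv \<psi> p) (at p)"
    and dF: "(F has_field_derivative deriv F p) (at p)"
    and d\<phi>: "(\<phi> has_field_derivative deriv \<phi> 0) (at 0)"
    using p1 hol holF by (auto intro!: holomorphic_derivI[OF _ open_ball])
  have "((\<lambda>z. \<psi> (\<phi> z)) has_field_derivative deriv \<psi> p * deriv \<phi> 0) (at 0)"
    using DERIV_chain2[of \<psi> _ \<phi>] d\<psi> d\<phi> vals by simp
  then have "((\<lambda>z. z) has_field_derivative deriv \<psi> p * deriv \<phi> 0) (at 0)"
    by (rule has_field_derivative_transform_within_open[of _ _ _ "ball 0 1"]) (auto simp: inv)
  then have one: "deriv \<psi> p * deriv \<phi> 0 = 1"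
    using DERIV_ident DERIV_unique by blast
  have "((\<lambda>z. F (\<phi> z)) has_field_derivative deriv F p * deriv \<phi> 0) (at 0)"
    using DERIV_chain2[of F _ \<phi>] dF d\<phi> vals by simp
  then have "((\<lambda>z. \<psi> (F (\<phi> z))) has_field_derivative deriv \<psi> p * (deriv F p * deriv \<phi> 0)) (at 0)"
    using DERIV_chain2[of \<psi> _ "\<lambda>z. F (\<phi> z)"] d\<psi> vals p(2) by simp
  then have "(G has_field_derivative deriv \<psi> p * (deriv F p * deriv \<phi> 0) / k) (at 0)"
    unfolding G_def by (rule DERIV_cdivide)
  moreover have "deriv \<psi> p * (deriv F p * deriv \<phi> 0) / k = deriv F p / k"
    using one by (simp add: mult.commute mult.left_commute)
  ultimately have "deriv G 0 = deriv F p / k"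
    by (simp add: DERIV_imp_deriv)
  then have "cmod (deriv F p) \<le> k"
    using Sch' k(1) by (simp add: norm_divide)
  then show ?thesis
    using that[of p] p1 p(2) conv k by auto
qed

lemma disc_self_map_attracting:
  assumes holF: "F holomorphic_on ball a t" and st: "s < t"
    and FD: "F ` ball a t \<subseteq> ball a s" and z0: "z0 \<in> ball a t"
  obtains p where "p \<in> ball a t" "F p = p" "cmod (deriv F p) < 1"
    "(\<lambda>n. (F ^^ n) z0) \<longlonglongrightarrow> p"
proof -
  have t: "0 < t"
    using z0 zero_le_dist[of a z0] by (simp del: zero_le_dist)
  define T where "T z = a + t * z" for z :: complex
  have TT: "T z \<in> ball a t \<longleftrightarrow> cmod z < 1" for z
    using t by (simp add: T_def dist_norm norm_mult)
  have Tinv: "T ((w - a) / t) = w" for w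
    using t by (simp add: T_def)
  define G where "G z = (F (T z) - a) / t" for z
  have TG: "T (G z) = F (T z)" for z
    using t by (simp add: T_def G_def)
  have "T holomorphic_on ball 0 1"
    unfolding T_def by (intro holomorphic_intros)
  then have "F \<circ> T holomorphic_on ball 0 1"
    by (rule holomorphic_on_compose_gen[OF _ holF]) (use TT in auto)
  then have holG: "G holomorphic_on ball 0 1"
    unfolding G_def o_def using t by (intro holomorphic_intros) auto
  have "cmod (G z) \<le> s / t" if "cmod z < 1" for z
  proof -
    have "F (T z) \<in> ball a s"
      using FD TT that by blast
    then show ?thesis
      using t by (simp add: G_def norm_divide dist_norm norm_minus_commute divide_right_mono)
  qed
  then obtain p where p: "cmod p < 1" "G p = p" "cmod (deriv G p) < 1"
    "\<And>z. cmod z < 1 \<Longrightarrow> (\<lambda>n. (G ^^ n) z) \<longlonglongrightarrow> p"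
    using unit_disc_self_map_attracting[OF holG, of "s / t"] st t by auto
  show ?thesis
  proof
    show Tp: "T p \<in> ball a t"
      using TT p(1) by simp
    show "F (T p) = T p"
      using TG p(2) by metis
    have "(F has_field_derivative deriv F (T p)) (at (T p))"
      using holomorphic_derivI[OF holF open_ball Tp] .
    moreover have "(T has_field_derivative t) (at p)"
      unfolding T_def by (auto intro!: derivative_eq_intros)
    ultimately have "((\<lambda>z. F (T z)) has_field_derivative deriv F (T p) * t) (at p)"
      using DERIV_chain2 by blast
    then have "(G has_field_derivative deriv F (T p)) (at p)"
      unfolding G_def using t by (auto intro!: derivative_eq_intros)
    then show "cmod (deriv F (T p)) < 1"
      using p(3) by (simp add: DERIV_imp_deriv)
    have "cmod ((z0 - a) / t) < 1"
      using z0 t by (simp add: norm_divide dist_norm norm_minus_commute)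
    then have "(\<lambda>n. T ((G ^^ n) ((z0 - a) / t))) \<longlonglongrightarrow> T p"
      unfolding T_def by (intro tendsto_intros p(4))
    moreover have "T ((G ^^ n) ((z0 - a) / t)) = (F ^^ n) z0" for n
      by (induction n) (simp_all add: TG Tinv)
    ultimately show "(\<lambda>n. (F ^^ n) z0) \<longlonglongrightarrow> T p"
      by simp
  qed
qed

section \<open>Orbits and inverse branches\<close>

text \<open>As \<open>f\<close> is a total function, its iterates also exist outside the domain; the
  first conjunct says that the first \<open>k\<close> applications take place inside
  \<open>V\<close>. The target \<open>T\<close> need not lie in \<open>V\<close>.\<close>

definition maps :: "complex set \<Rightarrow> (complex \<Rightarrow> complex) \<Rightarrow> nat \<Rightarrow> complex set \<Rightarrow> complex set \<Rightarrow> bool" where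
  "maps V f k S T \<longleftrightarrow> (\<forall>j<k. (f ^^ j) ` S \<subseteq> V) \<and> (f ^^ k) ` S \<subseteq> T"

lemma maps_mono: "maps V f k S T \<Longrightarrow> S' \<subseteq> S \<Longrightarrow> T \<subseteq> T' \<Longrightarrow> maps V f k S' T'"
  unfolding maps_def by (meson image_mono order_trans)

lemma maps_add:
  assumes "maps V f a S T" "maps V f b T U"
  shows "maps V f (a + b) S U"
  unfolding maps_def
proof (intro conjI allI impI)
  have split: "(f ^^ (a + i)) ` S = (f ^^ i) ` (f ^^ a) ` S" for i
    by (simp add: image_image funpow_add add.commute[of a])
  show "(f ^^ j) ` S \<subseteq> V" if "j < a + b" for j
  proof (cases "j < a")
    case False
    then have "(f ^^ j) ` S \<subseteq> (f ^^ (j - a)) ` T"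
      using split[of "j - a"] assms(1) by (auto simp: maps_def)
    moreover have "j - a < b"
      using False that by linarith
    ultimately show ?thesis
      using assms(2) unfolding maps_def by blast
  qed (use assms in \<open>auto simp: maps_def\<close>)
  show "(f ^^ (a + b)) ` S \<subseteq> U"
  proof -
    have "(f ^^ b) ` (f ^^ a) ` S \<subseteq> (f ^^ b) ` T"
      using assms(1) unfolding maps_def by (intro image_mono) simp
    then show ?thesis
      using split[of b] assms(2) unfolding maps_def by (simp only:) (meson order_trans)
  qed
qed

section \<open>Derivatives along the orbit and attraction to a cycle\<close>

locale orbit_in_domain =
  fixes V :: "complex set" and f :: "complex \<Rightarrow> complex" and c :: complex
  assumes openV: "open V" and holf: "f holomorphic_on V"
    and orbV: "(f ^^ n) c \<in> V"
begin

abbreviation orb :: "nat \<Rightarrow> complex" where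
  "orb n \<equiv> (f ^^ n) c"

text \<open>For \<open>a \<le> b\<close> this is the modulus of the derivative of
  \<open>f ^^ (b - a)\<close> at \<open>orb a\<close>.\<close>

definition orb_mult :: "nat \<Rightarrow> nat \<Rightarrow> real" where
  "orb_mult a b = (\<Prod>j\<in>{a..<b}. cmod (deriv f (orb j)))"

lemma orb_mult_chain: "a \<le> b \<Longrightarrow> b \<le> e \<Longrightarrow> orb_mult a b * orb_mult b e = orb_mult a e"
  unfolding orb_mult_def by (rule prod.atLeastLessThan_concat)

lemma orb_mult_refl [simp]: "orb_mult a a = 1"
  by (simp add: orb_mult_def)

lemma funpow_has_derivative:
  assumes "\<And>j. j < k \<Longrightarrow> (f ^^ j) z \<in> V"
  shows "(f ^^ k has_field_derivative (\<Prod>j<k. deriv f ((f ^^ j) z))) (at z)"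
  using assms
proof (induction k)
  case (Suc k)
  have "(f has_field_derivative deriv f ((f ^^ k) z)) (at ((f ^^ k) z))"
    using holomorphic_derivI[OF holf openV] Suc.prems by blast
  from DERIV_chain[OF this Suc.IH] show ?case
    using Suc.prems by (simp add: mult.commute o_def)
qed (simp add: id_def)

lemma orb_add: "(f ^^ j) (orb a) = orb (a + j)"
  by (simp add: funpow_add add.commute[of a])

lemma funpow_orb_has_derivative:
  obtains d where "(f ^^ k has_field_derivative d) (at (orb a))" "cmod d = orb_mult a (a + k)"
proof
  show "(f ^^ k has_field_derivative (\<Prod>j<k. deriv f ((f ^^ j) (orb a)))) (at (orb a))"
    using orbV by (intro funpow_has_derivative) (simp add: orb_add)
  have "(\<Prod>j<k. cmod (deriv f (orb (a + j)))) = (\<Prod>j\<in>{0 + a..<k + a}. cmod (deriv f (orb j)))"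
    unfolding prod.shift_bounds_nat_ivl by (simp add: lessThan_atLeast0 add.commute)
  then show "cmod (\<Prod>j<k. deriv f ((f ^^ j) (orb a))) = orb_mult a (a + k)"
    by (simp add: orb_mult_def orb_add add.commute flip: prod_norm)
qed

lemma funpow_holomorphic_on:
  assumes "maps V f k S T"
  shows "f ^^ k holomorphic_on S"
  unfolding holomorphic_on_def
proof
  fix z assume "z \<in> S"
  then have "(f ^^ j) z \<in> V" if "j < k" for j
    using assms that unfolding maps_def by blast
  from funpow_has_derivative[OF this] show "f ^^ k field_differentiable at z within S"
    unfolding field_differentiable_def using has_field_derivative_at_within by blast
qed

text \<open>An iterate that maps a disc into a smaller concentric one has an attracting fixed point
  there, and every point of the disc converges to it. One orbit point in the disc is enough.\<close>

lemma orbit_attracted: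
  assumes k: "k \<ge> 1" and st: "s < t" and maps: "maps V f k (ball a t) (ball a s)"
    and v: "orb v \<in> ball a t"
  shows "c \<in> AB V f"
proof -
  obtain p where p: "p \<in> ball a t" "(f ^^ k) p = p" "cmod (deriv (f ^^ k) p) < 1"
    "(\<lambda>n. ((f ^^ k) ^^ n) (orb v)) \<longlonglongrightarrow> p"
    using disc_self_map_attracting[OF funpow_holomorphic_on[OF maps] st _ v] maps unfolding maps_def
    by metis
  have per: "(f ^^ (n * k)) p = p" for n
    using p(2) by (induction n) (simp_all add: funpow_add)
  have pV: "(f ^^ j) p \<in> V" for j
  proof -
    have "(f ^^ j) p = (f ^^ (j mod k)) ((f ^^ (j div k * k)) p)"
      by (metis comp_apply funpow_add mod_div_mult_eq add.commute)
    also have "\<dots> \<in> V"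
      using maps p(1) k unfolding per maps_def by (simp add: image_subset_iff)
    finally show ?thesis .
  qed
  \<comment> \<open>\<open>AB\<close> looks at the orbit of \<open>c\<close> at multiples of
    \<open>k\<close>, but convergence is known from time \<open>v\<close> on; \<open>i\<close>
    further steps bring \<open>v\<close> to a multiple of \<open>k\<close>.\<close>
  obtain i q where i: "i < k" and q: "v + i = q * k"
  proof (cases "v mod k = 0")
    case True
    then show ?thesis
      using that[of 0 "v div k"] k div_mult_mod_eq[of v k] by simp
  next
    case False
    have "v + (k - v mod k) = (v div k + 1) * k"
      using mod_less_divisor[of k v] k div_mult_mod_eq[of v k] unfolding add_mult_distrib by linarith
    moreover have "k - v mod k < k"
      using False k by simp
    ultimately show ?thesis
      using that by blast
  qed
  have "isCont (f ^^ i) p"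
    using funpow_has_derivative[of i p] pV DERIV_isCont by blast
  then have "(\<lambda>n. (f ^^ i) (((f ^^ k) ^^ n) (orb v))) \<longlonglongrightarrow> (f ^^ i) p"
    using p(4) by (rule isCont_tendsto_compose)
  moreover have "(f ^^ i) (((f ^^ k) ^^ n) (orb v)) = orb ((n + q) * k)" for n
  proof -
    have "((f ^^ k) ^^ n) (orb v) = orb (v + n * k)"
      by (simp add: funpow_mult orb_add mult.commute)
    moreover have "v + n * k + i = (n + q) * k"
      using q by (simp add: add_mult_distrib)
    ultimately show ?thesis
      by (simp only: orb_add)
  qed
  ultimately have "(\<lambda>n. orb ((n + q) * k)) \<longlonglongrightarrow> (f ^^ i) p"
    by simp
  then have "(\<lambda>n. orb (n * k)) \<longlonglongrightarrow> (f ^^ i) p"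
    by (rule LIMSEQ_offset)
  moreover have "attracting_periodic V f p k"
    using k p pV by (simp add: attracting_periodic_def)
  moreover have "c \<in> V"
    using orbV[of 0] by simp
  ultimately show ?thesis
    unfolding AB_def using orbV i by blast
qed

end

text \<open>A named constant, so that the simplifier does not expand powers with this exponent.\<close>

definition koebe_exponent :: nat where "koebe_exponent = 2048"

lemma univalent_deriv_distortion:
  assumes "g holomorphic_on ball a r" "inj_on g (ball a r)" "w \<in> ball a r" "r / (r - dist a w) \<le> M"
  shows "cmod (deriv g a) \<le> M ^ koebe_exponent * cmod (deriv g w)"
    and "cmod (deriv g w) \<le> M ^ koebe_exponent * cmod (deriv g a)"
proof -
  have r: "0 < r" "dist a w < r"
    using assms(3) zero_le_dist[of a w] by (simp_all del: zero_le_dist)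
  have a: "a \<in> ball a r"
    using r by simp
  have nz: "cmod (deriv g a) > 0" "cmod (deriv g w) > 0"
    using holomorphic_injective_imp_regular[OF assms(1) open_ball assms(2)] a assms(3) by auto
  have "1 \<le> r / (r - dist a w)"
    using r by simp
  then have M: "1 \<le> M" "ln (r / (r - dist a w)) \<le> ln M"
    using assms(4) by (auto intro!: ln_mono)
  have L: "\<bar>ln (cmod (deriv g w)) - ln (cmod (deriv g a))\<bar> \<le> koebe_exponent * ln M"
    using univalent_log_deriv[OF assms(1-3)] M(2) by (simp add: koebe_exponent_def)
  have up: "x \<le> M ^ koebe_exponent * y" if "0 < x" "0 < y" "ln x - ln y \<le> koebe_exponent * ln M" for x y
  proof -
    have "ln x \<le> ln (M ^ koebe_exponent * y)"
      using that M by (simp add: ln_mult ln_realpow)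
    then show ?thesis
      using that M by simp
  qed
  show "cmod (deriv g a) \<le> M ^ koebe_exponent * cmod (deriv g w)"
    "cmod (deriv g w) \<le> M ^ koebe_exponent * cmod (deriv g a)"
    using up nz L by auto
qed

text \<open>The radii decrease to \<open>r / 2\<close> with polynomially small gaps, so the Koebe space at each step costs a factor
  that is polynomial, hence subexponential, in \<open>m\<close>.\<close>

definition shrink :: "real \<Rightarrow> nat \<Rightarrow> real" where
  "shrink r m = r * (1 / 2 + 1 / (2 * (real m + 1)))"

lemma shrink_0 [simp]: "shrink r 0 = r"
  by (simp add: shrink_def)

lemma shrink_bounds: "0 < r \<Longrightarrow> r / 2 < shrink r m \<and> shrink r m \<le> r"
  by (simp add: shrink_def field_simps)

lemma shrink_gap:
  assumes "0 < r" "1 \<le> m"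
  shows "r / (4 * (real m)\<^sup>2) \<le> shrink r (m - 1) - shrink r m"
proof -
  have m: "real (m - 1) + 1 = real m" "real m \<ge> 1"
    using assms by auto
  have "shrink r (m - 1) - shrink r m = r * (1 / (2 * real m) - 1 / (2 * (real m + 1)))"
    unfolding shrink_def m(1) by (simp add: algebra_simps)
  also have "\<dots> = r * (1 / (2 * real m * (real m + 1)))"
    using m(2) by (simp add: field_simps)
  also have "\<dots> \<ge> r * (1 / (4 * (real m)\<^sup>2))"
    using m(2) assms(1) by (intro mult_left_mono divide_left_mono) (auto simp: power2_eq_square)
  finally show ?thesis by simp
qed

text \<open>Factor by which the radius shrinks beyond the derivative in a pull-back of
  \<open>m\<close> steps: \<open>4 * (real m)\<^sup>2\<close> to the power
  \<open>koebe_exponent\<close> for distortion, once more for the gap between consecutive radii, and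
  32 from the weak quarter theorem.\<close>

definition loss :: "nat \<Rightarrow> real" where
  "loss m = 32 * (4 * (real m)\<^sup>2) ^ (koebe_exponent + 1)"

lemma loss_pos: "1 \<le> m \<Longrightarrow> loss m > 0"
  by (simp add: loss_def)

section \<open>Inverse branches along a non-periodic orbit\<close>

text \<open>Since the orbit never returns to \<open>c\<close>, the derivatives along it do not
  vanish, and each later orbit point has a disc around it that avoids \<open>c\<close>.\<close>

locale nonperiodic_orbit = orbit_in_domain +
  fixes V' :: "complex set" and \<rho> :: real
  assumes openV': "open V'" and VV': "V \<subseteq> V'"
    and cov: "covering_space (V - {z \<in> V. f z = c}) f (V' - {c})"
    and \<rho>0: "\<rho> > 0" and ball_V': "ball ((f ^^ n) c) \<rho> \<subseteq> V'"
    and nonper: "n \<ge> 1 \<Longrightarrow> (f ^^ n) c \<noteq> c"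
begin

text \<open>A covering map is locally injective, and an injective holomorphic function has no
  critical points.\<close>

lemma deriv_ne_0:
  assumes "z \<in> V" "f z \<noteq> c"
  shows "deriv f z \<noteq> 0"
proof -
  have "open (V - {z \<in> V. f z = c})"
  proof -
    have "V - {z \<in> V. f z = c} = V \<inter> f -` (- {c})"
      by auto
    then show ?thesis
      using holf openV by (metis continuous_open_preimage holomorphic_on_imp_continuous_on open_Compl closed_singleton)
  qed
  have zC: "z \<in> V - {z \<in> V. f z = c}"
    using assms by auto
  obtain T u q where u: "z \<in> u" "openin (top_of_set (V - {z \<in> V. f z = c})) u" "homeomorphism u T f q"
    using covering_space_local_homeomorphism[OF cov zC] by metis
  have "open u"
    using u(2) \<open>open (V - _)\<close> openin_open_eq by blast
  moreover have "u \<subseteq> V"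
    using u(2) openin_imp_subset by blast
  moreover have "inj_on f u"
    using u(3) by (metis homeomorphism_def inj_on_inverseI)
  ultimately show ?thesis
    using holomorphic_injective_imp_regular holf holomorphic_on_subset u(1) by blast
qed

lemma orb_mult_pos: "orb_mult a b > 0"
  unfolding orb_mult_def
proof (intro prod_pos)
  fix j
  have "f (orb j) \<noteq> c"
    using nonper[of "Suc j"] by simp
  then show "0 < cmod (deriv f (orb j))"
    using deriv_ne_0 orbV by simp
qed

text \<open>The inverse branch of \<open>f ^^ k\<close> that follows the orbit back from
  \<open>orb u\<close>. Its values are required in \<open>V'\<close>, the set over which the next
  lift takes place; for \<open>k = 0\<close> this is what (U2) provides.\<close>

definition branch :: "nat \<Rightarrow> nat \<Rightarrow> real \<Rightarrow> (complex \<Rightarrow> complex) \<Rightarrow> bool" where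
  "branch u k r g \<longleftrightarrow> g holomorphic_on ball (orb u) r \<and> g (orb u) = orb (u - k) \<and>
     (\<forall>y\<in>ball (orb u) r. g y \<in> V' \<and> (\<forall>j<k. (f ^^ j) (g y) \<in> V) \<and> (f ^^ k) (g y) = y)"

lemma branch_id: "r \<le> \<rho> \<Longrightarrow> branch u 0 r id"
  using ball_V'[of u] by (auto simp: branch_def)

lemma branch_mono: "branch u k r g \<Longrightarrow> r' \<le> r \<Longrightarrow> branch u k r' g"
  unfolding branch_def by (meson holomorphic_on_subset subset_ball subsetD)

lemma branch_inj: "branch u k r g \<Longrightarrow> inj_on g (ball (orb u) r)"
  unfolding branch_def by (metis inj_on_inverseI)

lemma branch_deriv:
  assumes "branch u k r g" "y \<in> ball (orb u) r"
  shows "(\<Prod>j<k. deriv f ((f ^^ j) (g y))) * deriv g y = 1"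
proof -
  have "(g has_field_derivative deriv g y) (at y)"
    using assms holomorphic_derivI open_ball unfolding branch_def by blast
  moreover have "(f ^^ k has_field_derivative (\<Prod>j<k. deriv f ((f ^^ j) (g y)))) (at (g y))"
    using assms unfolding branch_def by (intro funpow_has_derivative) blast
  ultimately have "((\<lambda>z. (f ^^ k) (g z)) has_field_derivative (\<Prod>j<k. deriv f ((f ^^ j) (g y))) * deriv g y) (at y)"
    using DERIV_chain2 by blast
  then have "((\<lambda>z. z) has_field_derivative (\<Prod>j<k. deriv f ((f ^^ j) (g y))) * deriv g y) (at y)"
    by (rule has_field_derivative_transform_within_open[OF _ open_ball assms(2)])
      (use assms(1) in \<open>auto simp: branch_def\<close>)
  then show ?thesis
    using DERIV_ident DERIV_unique by blast
qed

lemma branch_deriv_orb: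
  assumes "branch u k r g" "y \<in> ball (orb u) r" "g y = orb a"
  shows "cmod (deriv g y) = 1 / orb_mult a (a + k)"
proof -
  obtain d where d: "(f ^^ k has_field_derivative d) (at (orb a))" "cmod d = orb_mult a (a + k)"
    using funpow_orb_has_derivative by blast
  have "(f ^^ k has_field_derivative (\<Prod>j<k. deriv f ((f ^^ j) (orb a)))) (at (orb a))"
    using orbV by (intro funpow_has_derivative) (simp add: orb_add)
  then have "d * deriv g y = 1"
    using d(1) branch_deriv[OF assms(1,2)] assms(3) DERIV_unique by metis
  then have "orb_mult a (a + k) * cmod (deriv g y) = 1"
    using d(2) by (metis norm_mult norm_one)
  then show ?thesis
    using orb_mult_pos[of a "a + k"] by (simp add: field_simps)
qed

text \<open>A disc is simply connected, so a branch that omits \<open>c\<close> lifts through the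
  covering, starting from the previous orbit point.\<close>

lemma branch_lift:
  assumes br: "branch u k r g" and ku: "k < u" and r: "r > 0" and no: "c \<notin> g ` ball (orb u) r"
  obtains g' where "branch u (Suc k) r g'"
proof -
  define C where "C = V - {z \<in> V. f z = c}"
  have u: "orb u \<in> ball (orb u) r"
    using r by simp
  have next_orb: "f (orb (u - Suc k)) = orb (u - k)"
    using ku by (metis Suc_diff_Suc funpow.simps(2) o_apply)
  have gu: "g (orb u) = orb (u - k)"
    using br by (simp add: branch_def)
  have "orb (u - k) \<noteq> c"
    using no u gu by (metis imageI)
  then have start: "orb (u - Suc k) \<in> C"
    using orbV next_orb by (simp add: C_def)
  have gV': "g \<in> ball (orb u) r \<rightarrow> V' - {c}"
    using br no unfolding branch_def by blast
  have gcont: "continuous_on (ball (orb u) r) g"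
    using br unfolding branch_def by (blast intro: holomorphic_on_imp_continuous_on)
  have "simply_connected (ball (orb u) r)" "locally path_connected (ball (orb u) r)"
    by (simp_all add: convex_imp_simply_connected convex_imp_locally_path_connected)
  moreover have "g (orb u) = f (orb (u - Suc k))"
    using gu next_orb by simp
  ultimately obtain g' where g': "continuous_on (ball (orb u) r) g'" "g' \<in> ball (orb u) r \<rightarrow> C"
    "g' (orb u) = orb (u - Suc k)" "\<And>y. y \<in> ball (orb u) r \<Longrightarrow> f (g' y) = g y"
    using covering_space_lift_strong[OF cov[folded C_def] start u _ _ gcont gV'] by metis
  have props: "(\<forall>j<Suc k. (f ^^ j) (g' y) \<in> V) \<and> (f ^^ Suc k) (g' y) = y" if y: "y \<in> ball (orb u) r" for y
  proof (intro conjI allI impI)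
    show "(f ^^ Suc k) (g' y) = y"
      using g'(4)[OF y] br y by (simp add: funpow_Suc_right branch_def del: funpow.simps)
    fix j assume "j < Suc k"
    then show "(f ^^ j) (g' y) \<in> V"
    proof (cases j)
      case 0
      then show ?thesis using g'(2) y by (auto simp: C_def)
    next
      case (Suc i)
      then show ?thesis
        using g'(4)[OF y] br y \<open>j < Suc k\<close> by (simp add: funpow_Suc_right branch_def del: funpow.simps)
    qed
  qed
  \<comment> \<open>The lift is only known to be continuous; it is holomorphic as a continuous right
    inverse of \<open>f ^^ Suc k\<close>, whose derivative \<open>d\<close> does not vanish
    there.\<close>
  have "g' field_differentiable at y" if y: "y \<in> ball (orb u) r" for y
  proof -
    define d where "d = (\<Prod>j<Suc k. deriv f ((f ^^ j) (g' y)))"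
    have "(f ^^ Suc k has_field_derivative d) (at (g' y))"
      unfolding d_def using props[OF y] by (intro funpow_has_derivative) blast
    moreover have "d \<noteq> 0"
    proof -
      have "d = deriv f (g' y) * (\<Prod>j<k. deriv f ((f ^^ j) (g y)))"
        unfolding d_def prod.lessThan_Suc_shift using g'(4)[OF y]
        by (simp add: funpow_Suc_right del: funpow.simps)
      moreover have "deriv f (g' y) \<noteq> 0"
        using deriv_ne_0[of "g' y"] funcset_mem[OF g'(2) y] by (auto simp: C_def)
      moreover have "(\<Prod>j<k. deriv f ((f ^^ j) (g y))) \<noteq> 0"
        using branch_deriv[OF br y] by (metis mult_zero_left zero_neq_one)
      ultimately show ?thesis by simp
    qed
    moreover have "continuous (at y) g'"
      using g'(1) y continuous_on_eq_continuous_at open_ball by blast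
    ultimately have "(g' has_field_derivative inverse d) (at y)"
      using has_field_derivative_inverse_basic[of "f ^^ Suc k" d g' y "ball (orb u) r"] y props by blast
    then show ?thesis
      unfolding field_differentiable_def by blast
  qed
  then have "g' holomorphic_on ball (orb u) r"
    by (simp add: holomorphic_on_open open_ball field_differentiable_def)
  then have "branch u (Suc k) r g'"
    using g'(2,3) props VV' unfolding branch_def C_def by blast
  then show ?thesis ..
qed

text \<open>Lifting continues while the image of the shrunken disc omits \<open>c\<close>. It stops
  by time \<open>u\<close>, when the centre itself is sent to \<open>c\<close>. The branch lives on
  the larger radius \<open>shrink r (m - 1)\<close>, which leaves Koebe space around the
  hit.\<close>

lemma first_hit:
  assumes u: "1 \<le> u" and r: "0 < r" "r \<le> \<rho>" "r \<le> dist (orb u) c"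
  obtains m g where "1 \<le> m" "m \<le> u" "branch u m (shrink r (m - 1)) g" "c \<in> g ` ball (orb u) (shrink r m)"
proof -
  define hit where "hit m g \<longleftrightarrow> 1 \<le> m \<and> m \<le> u \<and> branch u m (shrink r (m - 1)) g
    \<and> c \<in> g ` ball (orb u) (shrink r m)" for m g
  \<comment> \<open>For \<open>k = 0\<close> the natural number \<open>k - 1\<close> is 0, so the
    identity starts on the full radius \<open>r\<close>.\<close>
  have "(\<exists>m g. hit m g) \<or> (\<exists>g. branch u k (shrink r (k - 1)) g)" if "k \<le> u" for k
    using that
  proof (induction k)
    case 0
    then show ?case
      using branch_id[of "shrink r (0 - 1)" u] r by auto
  next
    case (Suc k)
    then consider "\<exists>m g. hit m g" | g where "branch u k (shrink r (k - 1)) g" "\<not> hit k g"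
      by fastforce
    then show ?case
    proof cases
      case 2
      have le: "shrink r k \<le> shrink r (k - 1)"
      proof (cases "k = 0")
        case False
        then have "0 \<le> r / (4 * (real k)\<^sup>2)" "1 \<le> k"
          using r by auto
        then show ?thesis
          using shrink_gap[OF r(1), of k] by linarith
      qed simp
      have "c \<notin> g ` ball (orb u) (shrink r k)"
      proof (cases "k = 0")
        case True
        then have "g y = y" if "y \<in> ball (orb u) r" for y
          using 2(1) that by (simp add: branch_def)
        then show ?thesis
          using True r(3) by force
      next
        case False
        then show ?thesis
          using 2 Suc.prems by (auto simp: hit_def)
      qed
      then obtain g' where "branch u (Suc k) (shrink r k) g'"
        using branch_lift[OF branch_mono[OF 2(1) le]] Suc.prems shrink_bounds[OF r(1), of k] r(1)
        by (metis Suc_le_lessD half_gt_zero order_less_trans)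
      then show ?thesis
        by auto
    qed blast
  qed
  from this[OF order_refl] obtain m g where "hit m g"
  proof (elim disjE exE)
    fix g assume g: "branch u u (shrink r (u - 1)) g"
    then have "g (orb u) = c"
      by (simp add: branch_def)
    moreover have "0 < shrink r u"
      using shrink_bounds[OF r(1), of u] r(1) by linarith
    ultimately have "hit u g"
      using g u unfolding hit_def by (metis centre_in_ball imageI order_refl)
    then show ?thesis
      using that by blast
  qed (use that in blast)
  then show ?thesis
    using that by (auto simp: hit_def)
qed

text \<open>The point \<open>w\<close> sent to \<open>c\<close> by the branch is
  \<open>orb m\<close>, as \<open>f ^^ m\<close> undoes the branch. The weak quarter theorem at
  \<open>w\<close> and at the centre gives the discs around \<open>c\<close> and
  \<open>orb (u - m)\<close>; bounding the derivative of the branch gives their distance.\<close>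

lemma pull_back:
  assumes u: "1 \<le> u" and r: "0 < r" "r \<le> \<rho>" "r \<le> dist (orb u) c"
  obtains m t where "1 \<le> m" "m \<le> u" "dist (orb u) (orb m) < r"
    "dist (orb (u - m)) c \<le> r * (4 * (real m)\<^sup>2) ^ (2 * koebe_exponent) / orb_mult 0 m"
    "t = r / (loss m * orb_mult (u - m) u)" "inj_on f (ball c t)"
    "maps V f m (ball c t) (ball (orb u) r)" "maps V f m (ball (orb (u - m)) t) (ball (orb u) r)"
proof -
  obtain m g where m: "1 \<le> m" "m \<le> u" and br: "branch u m (shrink r (m - 1)) g"
    and "c \<in> g ` ball (orb u) (shrink r m)"
    using first_hit[OF assms] by blast
  then obtain w where w: "w \<in> ball (orb u) (shrink r m)" "g w = c"
    by blast
  define R where "R = shrink r (m - 1)"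
  define M where "M = 4 * (real m)\<^sup>2"
  define D where "D = orb_mult (u - m) u"
  define s where "s = R - dist (orb u) w"
  have D: "D > 0"
    using orb_mult_pos by (simp add: D_def)
  have "1 \<le> (real m)\<^sup>2"
    using m by simp
  then have M: "4 \<le> M"
    by (simp add: M_def)
  have R: "r / 2 \<le> R" "R \<le> r" "R > 0"
    using shrink_bounds[OF r(1), of "m - 1"] r(1) unfolding R_def by linarith+
  have s: "r / M \<le> s"
    using shrink_gap[OF r(1) m(1)] w(1) by (simp add: s_def R_def M_def)
  have "s > 0"
    using s r(1) M by (smt (verit) divide_pos_pos)
  then have wR: "w \<in> ball (orb u) R"
    by (simp add: s_def)
  have g: "g holomorphic_on ball (orb u) R" "g (orb u) = orb (u - m)" "inj_on g (ball (orb u) R)"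
    "\<And>y. y \<in> ball (orb u) R \<Longrightarrow> (\<forall>j<m. (f ^^ j) (g y) \<in> V) \<and> (f ^^ m) (g y) = y"
    using br branch_inj[OF br] unfolding branch_def R_def by blast+
  have wm: "w = orb m"
    using g(4)[OF wR] w(2) by simp
  have ratio: "R / (R - dist (orb u) z) \<le> M" if "dist (orb u) z \<le> dist (orb u) w" for z
  proof -
    have "R \<le> s * M"
      using s R M by (simp add: field_simps)
    also have "\<dots> \<le> (R - dist (orb u) z) * M"
      using that M by (intro mult_right_mono) (auto simp: s_def)
    finally show ?thesis
      using \<open>s > 0\<close> that by (simp add: s_def field_simps)
  qed
  have gu: "cmod (deriv g (orb u)) = 1 / D"
    using branch_deriv_orb[OF br, of "orb u" "u - m"] R g(2) m by (simp add: D_def R_def)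
  have gw: "cmod (deriv g w) = 1 / orb_mult 0 m"
    using branch_deriv_orb[OF br, of w 0] wR w(2) by (simp add: R_def)
  have dist1: "1 / D \<le> M ^ koebe_exponent * cmod (deriv g w)"
    using univalent_deriv_distortion(1)[OF g(1,3) wR ratio] gu by simp
  have dist2: "1 / D \<le> M ^ koebe_exponent * (1 / orb_mult 0 m)"
    using dist1 gw by simp
  define t where "t = r / (loss m * D)"
  \<comment> \<open>Here \<open>r / M\<close> bounds the gap between the radii from below,
    \<open>1 / D\<close> is the modulus of the derivative at the centre,
    \<open>M ^ koebe_exponent\<close> pays for passing to \<open>w\<close>, and 32 comes from the
    quarter theorem.\<close>
  have t_eq: "t = r / M * (1 / D) / (M ^ koebe_exponent * 32)"
    by (simp add: t_def loss_def M_def)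
  have image: "maps V f m S (ball (orb u) r) \<and> inj_on f S" if sub: "S \<subseteq> g ` ball (orb u) R" for S
  proof
    have "maps V f m (g ` ball (orb u) R) (ball (orb u) R)"
      using g(4) unfolding maps_def by auto
    then show "maps V f m S (ball (orb u) r)"
      using sub R(2) by (meson maps_mono subset_ball)
    show "inj_on f S"
    proof (rule inj_onI)
      fix x y assume xy: "x \<in> S" "y \<in> S" "f x = f y"
      obtain a b where ab: "a \<in> ball (orb u) R" "b \<in> ball (orb u) R" "x = g a" "y = g b"
        using xy sub by blast
      have "(f ^^ m) x = (f ^^ m) y"
        using xy(3) m(1) by (cases m) (simp_all add: funpow_Suc_right del: funpow.simps)
      then show "x = y"
        using g(4) ab by metis
    qed
  qed
  have "t \<le> s * cmod (deriv g w) / 32"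
  proof -
    have "r / M * (1 / D) \<le> s * (M ^ koebe_exponent * cmod (deriv g w))"
      using s dist1 D \<open>s > 0\<close> r(1) M by (intro mult_mono) auto
    then have "t \<le> s * (M ^ koebe_exponent * cmod (deriv g w)) / (M ^ koebe_exponent * 32)"
      unfolding t_eq using M by (intro divide_right_mono) auto
    also have "\<dots> = s * cmod (deriv g w) / 32"
      using M by simp
    finally show ?thesis .
  qed
  moreover have "ball w s \<subseteq> ball (orb u) R"
  proof
    fix y assume "y \<in> ball w s"
    then show "y \<in> ball (orb u) R"
      using dist_triangle[of "orb u" y w] by (simp add: s_def)
  qed
  then have "ball c (s * cmod (deriv g w) / 32) \<subseteq> g ` ball w s"
    using Koebe_quarter_weak[of g w s] \<open>s > 0\<close> g(1,3) w(2) holomorphic_on_subset inj_on_subset by metis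
  ultimately have subc: "ball c t \<subseteq> g ` ball (orb u) R"
    using \<open>ball w s \<subseteq> _\<close> by (meson image_mono order_trans subset_ball)
  have "t \<le> R * cmod (deriv g (orb u)) / 32"
  proof -
    have "r / M \<le> R"
      using R r(1) M frac_le[of r r 2 M] by linarith
    moreover have "1 \<le> M ^ koebe_exponent"
      using M by (simp add: one_le_power)
    ultimately have "r / M * (1 / D) \<le> R * (M ^ koebe_exponent * (1 / D))"
      using D R by (intro mult_mono) (auto simp: divide_right_mono)
    then have "t \<le> R * (M ^ koebe_exponent * (1 / D)) / (M ^ koebe_exponent * 32)"
      unfolding t_eq using M by (intro divide_right_mono) auto
    also have "\<dots> = R * cmod (deriv g (orb u)) / 32"
      using M by (simp add: gu)
    finally show ?thesis .
  qed
  moreover have "ball (orb (u - m)) (R * cmod (deriv g (orb u)) / 32) \<subseteq> g ` ball (orb u) R"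
    using Koebe_quarter_weak[OF g(1,3) R(3)] g(2) by simp
  ultimately have subu: "ball (orb (u - m)) t \<subseteq> g ` ball (orb u) R"
    by (meson order_trans subset_ball)
  have "dist (orb (u - m)) c \<le> r * M ^ (2 * koebe_exponent) / orb_mult 0 m"
  proof -
    \<comment> \<open>One power of \<open>M\<close> compares \<open>z\<close> with the centre, the
      other the centre with \<open>w\<close>, where the derivative has modulus
      \<open>1 / orb_mult 0 m\<close>.\<close>
    define B where "B = M ^ koebe_exponent * (M ^ koebe_exponent * (1 / orb_mult 0 m))"
    have "cmod (g (orb u) - g w) \<le> B * cmod (orb u - w)"
    proof (rule field_differentiable_bound)
      fix z assume "z \<in> cball (orb u) (dist (orb u) w)"
      then have zw: "dist (orb u) z \<le> dist (orb u) w"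
        by simp
      then have z: "z \<in> ball (orb u) R"
        using wR by simp
      show "(g has_field_derivative deriv g z) (at z within cball (orb u) (dist (orb u) w))"
        using g(1) z holomorphic_derivI by blast
      have "cmod (deriv g z) \<le> M ^ koebe_exponent * (1 / D)"
        using univalent_deriv_distortion(2)[OF g(1,3) z ratio[OF zw]] gu by simp
      also have "\<dots> \<le> B"
        using dist2 M unfolding B_def by (intro mult_left_mono) auto
      finally show "cmod (deriv g z) \<le> B" .
    qed auto
    also have "\<dots> \<le> B * r"
    proof (rule mult_left_mono)
      show "cmod (orb u - w) \<le> r"
        using wR R by (simp add: dist_norm)
      show "0 \<le> B"
        using M orb_mult_pos[of 0 m] by (simp add: B_def)
    qed
    also have "\<dots> = r * M ^ (2 * koebe_exponent) / orb_mult 0 m"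
      by (simp add: B_def mult_2 power_add)
    finally show ?thesis
      using g(2) w(2) by (simp add: dist_norm)
  qed
  moreover have "dist (orb u) (orb m) < r"
    using wR R wm by simp
  ultimately show ?thesis
    using that[of m t] m image[OF subc] image[OF subu] unfolding t_def D_def M_def by blast
qed

end

section \<open>Lower bounds for the derivative along the orbit\<close>

lemma loss_le_exp:
  assumes "0 < \<eta>"
  obtains M where "\<And>m. m \<ge> M \<Longrightarrow> B * loss m \<le> exp (\<eta> * real m)"
proof -
  define k where "k = 2 * (koebe_exponent + 1)"
  define A where "A = B * 32 * 4 ^ (koebe_exponent + 1) / \<eta> ^ k"
  have eq: "B * loss m = A * (\<eta> * real m) ^ k" for m
    using assms by (simp add: loss_def A_def k_def power_mult_distrib power_mult power2_eq_square)
  have "filterlim (\<lambda>m. \<eta> * real m) at_top sequentially"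
    using assms by (intro filterlim_tendsto_pos_mult_at_top[OF tendsto_const] filterlim_real_sequentially)
  from filterlim_compose[OF tendsto_power_div_exp_0 this]
  have "(\<lambda>m. A * ((\<eta> * real m) ^ k / exp (\<eta> * real m))) \<longlonglongrightarrow> A * 0"
    by (intro tendsto_intros)
  then have "\<forall>\<^sub>F m in sequentially. A * ((\<eta> * real m) ^ k / exp (\<eta> * real m)) < 1"
    by (rule order_tendstoD) simp
  then obtain M where "\<And>m. m \<ge> M \<Longrightarrow> A * ((\<eta> * real m) ^ k / exp (\<eta> * real m)) < 1"
    by (auto simp: eventually_sequentially)
  then have "B * loss m \<le> exp (\<eta> * real m)" if "m \<ge> M" for m
    using that unfolding eq by (smt (verit) divide_less_eq_1 exp_gt_zero times_divide_eq_right)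
  then show ?thesis ..
qed

text \<open>
  Closeness to \<open>c\<close> by \<open>\<delta>\<close> forces the next hitting time to be at least \<open>N\<close>, long enough to pay
  for the losses of two steps; a hitting time below \<open>M\<close>, whose loss is not absorbed by \<open>exp (\<eta> m)\<close>,
  leads to such a point. The weight \<open>1 / G\<close> of far points records the loss that is still to be paid.
\<close>

locale weighted_orbit = nonperiodic_orbit +
  fixes \<eta> \<delta> \<epsilon> G :: real and M N :: nat
  assumes \<eta>: "\<eta> > 0" and G: "G \<ge> 1" and \<epsilon>: "0 < \<epsilon>" "\<epsilon> \<le> \<rho>" "\<epsilon> \<le> \<delta>"
    and loss_M: "M \<le> m \<Longrightarrow> 8 * loss m \<le> exp (\<eta> * real m)"
    and loss_G: "1 \<le> m \<Longrightarrow> m < M \<Longrightarrow> 8 * loss m \<le> G"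
    and loss_N: "N \<le> m \<Longrightarrow> 8 * G * loss m \<le> exp (\<eta> * real m)"
    and far: "1 \<le> m \<Longrightarrow> m < N \<Longrightarrow> 2 * \<delta> \<le> dist (orb m) c"
    and near: "1 \<le> m \<Longrightarrow> m < M \<Longrightarrow> \<epsilon> * (4 * (real m)\<^sup>2) ^ (2 * koebe_exponent) / orb_mult 0 m < \<delta>"
begin

section \<open>Paying for the losses by weights\<close>

definition wt :: "nat \<Rightarrow> real" where
  "wt u = (if dist (orb u) c < \<delta> then 1 else 1 / G)"

text \<open>The largest radius, up to the cap \<open>\<epsilon>\<close>, at which the disc around
  \<open>orb v\<close> still avoids \<open>c\<close>.\<close>

definition rad :: "nat \<Rightarrow> real" where
  "rad v = min \<epsilon> (dist (orb v) c)"

lemma wt_bounds: "1 / G \<le> wt u" "wt u \<le> 1" "0 < wt u"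
  using G by (auto simp: wt_def)

lemma wt_0: "wt 0 = 1"
  using \<epsilon> by (simp add: wt_def)

lemma rad_pos: "1 \<le> v \<Longrightarrow> 0 < rad v"
  using nonper[of v] \<epsilon> by (simp add: rad_def)

text \<open>If \<open>orb u\<close> is near \<open>c\<close>, so is \<open>orb m\<close>, hence
  \<open>m \<ge> N\<close> and the exponential pays even for the extra \<open>G\<close>. Otherwise
  the weight of \<open>u\<close> is \<open>1 / G\<close>: for \<open>m \<ge> M\<close> the
  exponential pays, and for smaller \<open>m\<close> the point \<open>orb (u - m)\<close> is near
  \<open>c\<close>, so the rise of the weight to 1 pays. The factor 8 is slack for the
  restarts.\<close>

lemma weighted_step:
  assumes u: "1 \<le> u" and r: "0 < r" "r \<le> rad u"
  obtains m t where "1 \<le> m" "m \<le> u" "0 < t" "inj_on f (ball c t)"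
    "maps V f m (ball c t) (ball (orb u) r)" "maps V f m (ball (orb (u - m)) t) (ball (orb u) r)"
    "8 * r * wt u * exp (- \<eta> * real m) \<le> wt (u - m) * orb_mult (u - m) u * t"
proof -
  have rr: "r \<le> \<rho>" "r \<le> \<epsilon>" "r \<le> dist (orb u) c"
    using r(2) \<epsilon> by (auto simp: rad_def)
  obtain m t where m: "1 \<le> m" "m \<le> u" "dist (orb u) (orb m) < r"
    "dist (orb (u - m)) c \<le> r * (4 * (real m)\<^sup>2) ^ (2 * koebe_exponent) / orb_mult 0 m"
    and t: "t = r / (loss m * orb_mult (u - m) u)"
    and fits: "inj_on f (ball c t)" "maps V f m (ball c t) (ball (orb u) r)"
      "maps V f m (ball (orb (u - m)) t) (ball (orb u) r)"
    using pull_back[OF u r(1) rr(1,3)] by blast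
  have pos: "loss m > 0" "orb_mult (u - m) u > 0"
    using loss_pos m(1) orb_mult_pos by auto
  have "8 * loss m * wt u \<le> wt (u - m) * exp (\<eta> * real m)"
  proof (cases "dist (orb u) c < \<delta>")
    case True
    have "dist (orb m) c < 2 * \<delta>"
      using True m(3) rr(2) \<epsilon>(3) dist_triangle[of "orb m" c "orb u"] by (simp add: dist_commute)
    then have "N \<le> m"
      using far[OF m(1)] by linarith
    then have "8 * loss m \<le> exp (\<eta> * real m) / G"
      using loss_N G by (simp add: field_simps)
    also have "\<dots> \<le> wt (u - m) * exp (\<eta> * real m)"
      using wt_bounds(1)[of "u - m"] mult_right_mono[of "1 / G" _ "exp (\<eta> * real m)"] by simp
    finally show ?thesis
      using True by (simp add: wt_def[of u])
  next
    case False
    then have wu: "wt u = 1 / G"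
      by (simp add: wt_def)
    show ?thesis
    proof (cases "M \<le> m")
      case True
      then have "8 * loss m * (1 / G) \<le> exp (\<eta> * real m) * wt (u - m)"
        using loss_M wt_bounds[of "u - m"] G pos by (intro mult_mono) auto
      then show ?thesis
        by (simp add: wu mult.commute)
    next
      case False
      have "dist (orb (u - m)) c \<le> \<epsilon> * (4 * (real m)\<^sup>2) ^ (2 * koebe_exponent) / orb_mult 0 m"
        using m(4) rr(2) orb_mult_pos[of 0 m]
        by (elim order_trans) (intro divide_right_mono mult_right_mono, auto)
      then have "wt (u - m) = 1"
        using near[OF m(1)] False by (simp add: wt_def)
      moreover have "8 * loss m * (1 / G) \<le> 1"
        using loss_G[OF m(1)] False G by (simp add: field_simps)
      moreover have "1 \<le> exp (\<eta> * real m)"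
        using \<eta> by simp
      ultimately show ?thesis
        unfolding wu by (metis mult_1 order_trans)
    qed
  qed
  then have "8 * loss m * wt u * (r / loss m * exp (- \<eta> * real m))
      \<le> wt (u - m) * exp (\<eta> * real m) * (r / loss m * exp (- \<eta> * real m))"
    using r(1) pos by (intro mult_right_mono) auto
  then have "8 * r * wt u * exp (- \<eta> * real m) \<le> wt (u - m) * (r / loss m)"
    using pos by (simp add: exp_minus field_simps)
  also have "\<dots> = wt (u - m) * orb_mult (u - m) u * t"
    using pos unfolding t by simp
  finally show ?thesis
    using that[of m t] m(1,2) fits t r(1) pos by simp
qed

text \<open>
  The discs are pulled back from \<open>v\<close> until the radius reaches four times the largest admissible
  restarting radius \<open>rad v'\<close>; meanwhile the product of radius and derivative telescopes.
\<close>

lemma pull_back_until_restart: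
  assumes v: "1 \<le> v"
    and bound: "\<And>k t. 1 \<le> k \<Longrightarrow> 0 < t \<Longrightarrow> inj_on f (ball c t) \<Longrightarrow>
      maps V f k (ball c t) (ball (orb v) (rad v)) \<Longrightarrow> t \<le> T"
  obtains v' where "v' < v" "wt v * exp (- \<eta> * real (v - v')) * rad v * 8 \<le> wt v' * T * orb_mult v' v"
    "dist (orb v) (orb (v - v')) < rad v"
    "v' = 0 \<or> maps V f (v - v') (ball (orb v') (4 * rad v')) (ball (orb v) (rad v))"
proof -
  define good where "good v' \<longleftrightarrow> v' < v \<and>
    wt v * exp (- \<eta> * real (v - v')) * rad v * 8 \<le> wt v' * T * orb_mult v' v \<and>
    dist (orb v) (orb (v - v')) < rad v \<and>
    (v' = 0 \<or> maps V f (v - v') (ball (orb v') (4 * rad v')) (ball (orb v) (rad v)))" for v'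
  have "\<exists>v'. good v'" if "1 \<le> u" "u \<le> v" "0 < r" "r \<le> rad u"
    "maps V f (v - u) (ball (orb u) r) (ball (orb v) (rad v))"
    "wt v * exp (- \<eta> * real (v - u)) * rad v \<le> wt u * r * orb_mult u v" for u r
    using that
  proof (induction u arbitrary: r rule: less_induct)
    case (less u)
    obtain m t where m: "1 \<le> m" "m \<le> u" and t: "0 < t" "inj_on f (ball c t)"
      and maps: "maps V f m (ball c t) (ball (orb u) r)" "maps V f m (ball (orb (u - m)) t) (ball (orb u) r)"
      and ineq: "8 * r * wt u * exp (- \<eta> * real m) \<le> wt (u - m) * orb_mult (u - m) u * t"
      using weighted_step[OF less.prems(1,3,4)] by blast
    define u' where "u' = u - m"
    have u': "u' < u" "v - u' = m + (v - u)" "u' \<le> u"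
      using m less.prems(2) by (auto simp: u'_def)
    have maps': "maps V f (v - u') (ball c t) (ball (orb v) (rad v))"
      "maps V f (v - u') (ball (orb u') t) (ball (orb v) (rad v))"
      unfolding u'(2) using maps_add maps less.prems(5) unfolding u'_def by blast+
    \<comment> \<open>The a priori bound concerns the disc around \<open>c\<close>; the disc around
      \<open>orb u'\<close> has the same radius.\<close>
    have tT: "t \<le> T"
      using bound[OF _ t maps'(1)] u' m by simp
    have "orb (v - u') \<in> ball (orb v) (rad v)"
      using maps'(1) t(1) unfolding maps_def by (meson centre_in_ball image_subset_iff)
    then have hit: "dist (orb v) (orb (v - u')) < rad v"
      by simp
    have "wt v * exp (- \<eta> * real (v - u')) * rad v * 8
        = wt v * exp (- \<eta> * real (v - u)) * rad v * (8 * exp (- \<eta> * real m))"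
      unfolding u'(2) by (simp add: algebra_simps flip: exp_add)
    also have "\<dots> \<le> wt u * r * orb_mult u v * (8 * exp (- \<eta> * real m))"
      using less.prems(6) by (rule mult_right_mono) simp
    also have "\<dots> = 8 * r * wt u * exp (- \<eta> * real m) * orb_mult u v"
      by simp
    also have "\<dots> \<le> wt u' * orb_mult u' u * t * orb_mult u v"
      using ineq orb_mult_pos[of u v] unfolding u'_def by (intro mult_right_mono) auto
    also have "\<dots> = wt u' * t * orb_mult u' v"
      using orb_mult_chain[OF u'(3) less.prems(2)] by (simp add: mult.commute mult.left_commute)
    finally have key: "wt v * exp (- \<eta> * real (v - u')) * rad v * 8 \<le> wt u' * t * orb_mult u' v" .
    \<comment> \<open>If \<open>t\<close> is below \<open>4 * rad u'\<close>, the radius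
      \<open>t / 4\<close> is admissible at \<open>u'\<close> and the induction goes on, spending 4
      out of the slack 8.\<close>
    show ?case
    proof (cases "u' = 0 \<or> 4 * rad u' \<le> t")
      case True
      have "wt u' * t * orb_mult u' v \<le> wt u' * T * orb_mult u' v"
        using tT wt_bounds(3)[of u'] orb_mult_pos[of u' v] by (intro mult_right_mono mult_left_mono) auto
      then have "good u'"
        using key True hit u' less.prems(2) maps'(2) maps_mono[OF maps'(2) subset_ball order_refl]
        unfolding good_def by auto
      then show ?thesis ..
    next
      case False
      have "0 \<le> wt v * exp (- \<eta> * real (v - u')) * rad v"
        using wt_bounds(3)[of v] rad_pos[OF v] by simp
      then have "wt v * exp (- \<eta> * real (v - u')) * rad v \<le> wt u' * (t / 4) * orb_mult u' v"
        using key by simp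
      moreover have "maps V f (v - u') (ball (orb u') (t / 4)) (ball (orb v) (rad v))"
        using t(1) by (intro maps_mono[OF maps'(2) subset_ball order_refl]) simp
      ultimately show ?thesis
        using less.IH[of u' "t / 4"] False u' less.prems(2) t(1) by simp
    qed
  qed
  from this[of v "rad v"] obtain v' where "good v'"
    using v rad_pos[OF v] by (auto simp: maps_def)
  then show ?thesis
    using that unfolding good_def by blast
qed

text \<open>Each passage from \<open>v\<close> back to \<open>v'\<close> either costs nothing beyond
  the exponential or costs one factor \<open>\<epsilon> / R\<close> and puts a new return time below
  \<open>L\<close> into \<open>Q\<close>. Hence this factor is lost at most \<open>L\<close>
  times.\<close>

lemma orb_mult_lower_bound:
  assumes notAB: "c \<notin> AB V f"
    and R: "\<epsilon> \<le> R" "\<And>t. ball c t \<subseteq> V \<Longrightarrow> inj_on f (ball c t) \<Longrightarrow> t \<le> R"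
    and L: "R / \<epsilon> \<le> exp (\<eta> * real L)"
  shows "1 / G * (\<epsilon> / R) ^ L * exp (- 2 * \<eta> * real n) \<le> orb_mult 0 n"
proof -
  \<comment> \<open>\<open>Q\<close> collects return times \<open>i < L\<close> at which the factor \<open>\<epsilon> / R\<close> was already lost, from a disc around
    \<open>orb p\<close> close to \<open>orb i\<close>; a second loss with the same \<open>i\<close> would give an attracting cycle.\<close>
  define paid where "paid v Q \<longleftrightarrow> Q \<subseteq> {..<L} \<and> (\<forall>i\<in>Q. \<exists>p>v. dist (orb p) (orb i) < \<epsilon> \<and>
    maps V f (p - v) (ball (orb v) (4 * rad v)) (ball (orb p) \<epsilon>))" for v Q
  \<comment> \<open>The exponent \<open>L - card Q\<close> counts the losses still possible. Of the
    rate \<open>2 * \<eta>\<close>, one half pays for the pull-backs, the other for growth over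
    return times of at least \<open>L\<close>.\<close>
  define low where "low v Q \<longleftrightarrow> wt v * (\<epsilon> / R) ^ (L - card Q) * exp (- 2 * \<eta> * real v) \<le> orb_mult 0 v" for v :: nat and Q :: "nat set"
  have \<epsilon>R: "0 < \<epsilon> / R" "\<epsilon> / R \<le> 1"
    using \<epsilon> R(1) by auto
  have low0: "low 0 Q" for Q
    using \<epsilon>R by (simp add: low_def wt_0 power_le_one)
  have paid_step: "paid v' Q" if "paid v Q" "v' < v" "maps V f (v - v') (ball (orb v') (4 * rad v')) (ball (orb v) (rad v))"
    for v v' Q
    unfolding paid_def
  proof (intro conjI ballI)
    show "Q \<subseteq> {..<L}"
      using that(1) by (simp add: paid_def)
    fix i assume "i \<in> Q"
    with that(1) have "\<exists>p>v. dist (orb p) (orb i) < \<epsilon> \<and>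
        maps V f (p - v) (ball (orb v) (4 * rad v)) (ball (orb p) \<epsilon>)"
      unfolding paid_def by (elim conjE) (rule bspec)
    then obtain p where p: "p > v" "dist (orb p) (orb i) < \<epsilon>"
      "maps V f (p - v) (ball (orb v) (4 * rad v)) (ball (orb p) \<epsilon>)"
      by (elim exE conjE)
    have "rad v \<le> 4 * rad v"
      using \<epsilon>(1) by (simp add: rad_def)
    then have "maps V f (p - v) (ball (orb v) (rad v)) (ball (orb p) \<epsilon>)"
      using p(3) by (meson maps_mono subset_ball order_refl)
    from maps_add[OF that(3) this]
    have "maps V f (p - v') (ball (orb v') (4 * rad v')) (ball (orb p) \<epsilon>)"
      using that(2) p(1) by simp
    then show "\<exists>p>v'. dist (orb p) (orb i) < \<epsilon> \<and> maps V f (p - v') (ball (orb v') (4 * rad v')) (ball (orb p) \<epsilon>)"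
      using p(1,2) that(2) by (intro exI[of _ p] conjI) simp_all
  qed
  have combine: "low v Q" if "v' < v" "low v' Q'" "0 \<le> x" "x * (\<epsilon> / R) ^ (L - card Q') = (\<epsilon> / R) ^ (L - card Q)"
    "wt v * x * exp (- 2 * \<eta> * real (v - v')) \<le> wt v' * orb_mult v' v" for v v' Q Q' x
  proof -
    have "wt v * (\<epsilon> / R) ^ (L - card Q) * exp (- 2 * \<eta> * real v)
        = (\<epsilon> / R) ^ (L - card Q') * exp (- 2 * \<eta> * real v') * (wt v * x * exp (- 2 * \<eta> * real (v - v')))"
      using that(1) unfolding that(4)[symmetric] by (simp add: of_nat_diff algebra_simps flip: exp_add)
    also have "\<dots> \<le> (\<epsilon> / R) ^ (L - card Q') * exp (- 2 * \<eta> * real v') * (wt v' * orb_mult v' v)"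
      using that(5) \<epsilon>R by (intro mult_left_mono) auto
    also have "\<dots> = wt v' * (\<epsilon> / R) ^ (L - card Q') * exp (- 2 * \<eta> * real v') * orb_mult v' v"
      by simp
    also have "\<dots> \<le> orb_mult 0 v' * orb_mult v' v"
      using that(2) orb_mult_pos[of v' v] unfolding low_def by (intro mult_right_mono) auto
    also have "\<dots> = orb_mult 0 v"
      using that(1) by (intro orb_mult_chain) auto
    finally show ?thesis
      by (simp add: low_def)
  qed
  have main: "low v Q" if "paid v Q" for v Q
    using that
  proof (induction v arbitrary: Q rule: less_induct)
    case (less v)
    show ?case
    proof (cases "v = 0")
      case False
      then have v: "1 \<le> v"
        by simp
      have IH: "low v' Q'" if "v' < v" "v' = 0 \<or> paid v' Q'" for v' Q'
        using that low0 less.IH by blast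
      have exp2: "exp (- 2 * \<eta> * real k) \<le> exp (- \<eta> * real k)" for k
        using \<eta> by simp
      show ?thesis
      proof (cases "dist (orb v) c \<le> \<epsilon>")
        case True
        then have rad: "rad v = dist (orb v) c"
          by (simp add: rad_def)
        \<comment> \<open>The disc around \<open>orb v\<close> has \<open>c\<close> on its boundary
          and lies in \<open>ball c (2 * rad v)\<close>. A larger disc around \<open>c\<close>
          mapped into it would make \<open>c\<close> attracted to a cycle, so
          \<open>T = 2 * rad v\<close>.\<close>
        obtain v' where v': "v' < v" "wt v * exp (- \<eta> * real (v - v')) * rad v * 8 \<le> wt v' * (2 * rad v) * orb_mult v' v"
          "v' = 0 \<or> maps V f (v - v') (ball (orb v') (4 * rad v')) (ball (orb v) (rad v))"
        proof (rule pull_back_until_restart[OF v, of "2 * rad v"])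
          fix k t assume k: "1 \<le> k" "0 < t" and maps: "maps V f k (ball c t) (ball (orb v) (rad v))"
          show "t \<le> 2 * rad v"
          proof (rule ccontr)
            assume "\<not> t \<le> 2 * rad v"
            then have "2 * rad v < t"
              by simp
            moreover have "ball (orb v) (rad v) \<subseteq> ball c (2 * rad v)"
            proof
              fix y assume "y \<in> ball (orb v) (rad v)"
              then show "y \<in> ball c (2 * rad v)"
                using rad dist_triangle[of c y "orb v"] by (simp add: dist_commute)
            qed
            ultimately have "c \<in> AB V f"
              using orbit_attracted[OF k(1) _ maps_mono[OF maps order_refl], of "2 * rad v" 0] k(2) by simp
            then show False
              using notAB by simp
          qed
        qed (use that in blast)
        have "wt v * exp (- \<eta> * real (v - v')) * 4 \<le> wt v' * orb_mult v' v"
          using v'(2) rad_pos[OF v] by (simp add: field_simps)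
        moreover have "0 \<le> wt v * exp (- \<eta> * real (v - v'))"
          using wt_bounds(3)[of v] by simp
        moreover have "wt v * exp (- 2 * \<eta> * real (v - v')) \<le> wt v * exp (- \<eta> * real (v - v'))"
          using exp2 wt_bounds(3)[of v] by (intro mult_left_mono) auto
        ultimately have "wt v * 1 * exp (- 2 * \<eta> * real (v - v')) \<le> wt v' * orb_mult v' v"
          by linarith
        moreover have "low v' Q"
          using IH[OF v'(1)] v'(1,3) paid_step[OF less.prems] by blast
        ultimately show ?thesis
          using v'(1) by (intro combine[of v' v Q 1 Q]) auto
      next
        case False
        then have rad: "rad v = \<epsilon>"
          by (simp add: rad_def)
        obtain v' where v': "v' < v" "wt v * exp (- \<eta> * real (v - v')) * rad v * 8 \<le> wt v' * R * orb_mult v' v"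
          "dist (orb v) (orb (v - v')) < rad v"
          "v' = 0 \<or> maps V f (v - v') (ball (orb v') (4 * rad v')) (ball (orb v) (rad v))"
        proof (rule pull_back_until_restart[OF v, of R])
          fix k t assume k: "1 \<le> k" "inj_on f (ball c t)" "maps V f k (ball c t) (ball (orb v) (rad v))"
          then have "(f ^^ 0) ` ball c t \<subseteq> V"
            unfolding maps_def by (metis One_nat_def Suc_le_lessD)
          then show "t \<le> R"
            using R(2) k(2) by simp
        qed (use that in blast)
        define k where "k = v - v'"
        have "0 \<le> wt v * exp (- \<eta> * real k) * \<epsilon>"
          using wt_bounds(3)[of v] \<epsilon>(1) by simp
        then have "wt v * exp (- \<eta> * real k) * \<epsilon> \<le> wt v' * R * orb_mult v' v"
          using v'(2) unfolding rad k_def[symmetric] by linarith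
        then have base: "wt v * (\<epsilon> / R) * exp (- \<eta> * real k) \<le> wt v' * orb_mult v' v"
          using R(1) \<epsilon>(1) by (simp add: field_simps)
        show ?thesis
        proof (cases "L \<le> k")
          case True
          \<comment> \<open>A long return time: the second half of the rate absorbs the factor
            \<open>\<epsilon> / R\<close>.\<close>
          have "exp (- \<eta> * real k) \<le> exp (- \<eta> * real L)"
            using True \<eta> by simp
          also have "\<dots> \<le> \<epsilon> / R"
            using L \<epsilon>R(1) \<epsilon>(1) R(1) by (simp add: exp_minus field_simps)
          finally have "wt v * (exp (- \<eta> * real k) * exp (- \<eta> * real k)) \<le> wt v * ((\<epsilon> / R) * exp (- \<eta> * real k))"
            using wt_bounds(3)[of v] by (intro mult_left_mono mult_right_mono) auto
          moreover have "exp (- \<eta> * real k) * exp (- \<eta> * real k) = exp (- 2 * \<eta> * real k)"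
            by (simp flip: exp_add)
          ultimately have "wt v * 1 * exp (- 2 * \<eta> * real (v - v')) \<le> wt v' * orb_mult v' v"
            using base by (simp add: k_def)
          moreover have "low v' Q"
            using IH[OF v'(1)] v'(1,4) paid_step[OF less.prems] by blast
          ultimately show ?thesis
            using v'(1) by (intro combine[of v' v Q 1 Q]) auto
        next
          case False
          have Q: "Q \<subseteq> {..<L}" "finite Q"
            using less.prems finite_subset unfolding paid_def by auto
          have near_k: "dist (orb v) (orb k) < \<epsilon>"
            using v'(3) rad by (simp add: k_def)
          \<comment> \<open>Otherwise \<open>orb p\<close> and \<open>orb v\<close> are both within
            \<open>\<epsilon>\<close> of \<open>orb k\<close>, and \<open>f ^^ (p - v)\<close> maps
            the disc of radius \<open>4 * \<epsilon>\<close> around \<open>orb v\<close> into the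
            one of radius \<open>3 * \<epsilon>\<close>. This is why discs restart only at four
            times \<open>rad\<close>.\<close>
          have "k \<notin> Q"
          proof
            assume "k \<in> Q"
            then obtain p where p: "p > v" "dist (orb p) (orb k) < \<epsilon>"
              "maps V f (p - v) (ball (orb v) (4 * \<epsilon>)) (ball (orb p) \<epsilon>)"
              using less.prems rad unfolding paid_def by metis
            have "ball (orb p) \<epsilon> \<subseteq> ball (orb v) (3 * \<epsilon>)"
            proof
              fix y assume "y \<in> ball (orb p) \<epsilon>"
              then show "y \<in> ball (orb v) (3 * \<epsilon>)"
                using p(2) near_k dist_triangle[of "orb v" y "orb p"] dist_triangle2[of "orb v" "orb p" "orb k"]
                by simp
            qed
            then have "c \<in> AB V f"
              using orbit_attracted[OF _ _ maps_mono[OF p(3) order_refl], of "3 * \<epsilon>" v] p(1) \<epsilon>(1) by simp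
            then show False
              using notAB by simp
          qed
          have cardQ: "card (insert k Q) = Suc (card Q)" "card (insert k Q) \<le> L"
            using Q False \<open>k \<notin> Q\<close> card_mono[of "{..<L}" "insert k Q"] by auto
          have "low v' (insert k Q)"
          proof (rule IH[OF v'(1)])
            show "v' = 0 \<or> paid v' (insert k Q)"
            proof (cases "v' = 0")
              case v'0: False
              then have "paid v' Q"
                using paid_step[OF less.prems v'(1)] v'(4) by blast
              moreover have "maps V f (v - v') (ball (orb v') (4 * rad v')) (ball (orb v) \<epsilon>)"
                using v'(4) v'0 rad by simp
              ultimately show ?thesis
                using near_k v'(1) False unfolding paid_def by auto
            qed simp
          qed
          moreover have "(\<epsilon> / R) * (\<epsilon> / R) ^ (L - card (insert k Q)) = (\<epsilon> / R) ^ (L - card Q)"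
          proof -
            have "L - card Q = Suc (L - card (insert k Q))"
              using cardQ by simp
            then show ?thesis
              by simp
          qed
          moreover have "wt v * (\<epsilon> / R) * exp (- 2 * \<eta> * real (v - v')) \<le> wt v' * orb_mult v' v"
          proof -
            have "0 \<le> wt v * (\<epsilon> / R)"
              using \<epsilon>R wt_bounds(3)[of v] by (intro mult_nonneg_nonneg) auto
            from mult_left_mono[OF exp2[of k] this] base show ?thesis
              unfolding k_def by linarith
          qed
          ultimately show ?thesis
            using v'(1) \<epsilon>R by (intro combine[of v' v "insert k Q" "\<epsilon> / R" Q]) auto
        qed
      qed
    qed (simp add: low0)
  qed
  have "low n {}"
    by (rule main) (simp add: paid_def)
  moreover have "1 / G * ((\<epsilon> / R) ^ L * exp (- 2 * \<eta> * real n)) \<le> wt n * ((\<epsilon> / R) ^ L * exp (- 2 * \<eta> * real n))"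
    using wt_bounds(1) \<epsilon>R by (intro mult_right_mono) auto
  ultimately show ?thesis
    by (simp add: low_def)
qed

end

section \<open>Special cases: affine maps and periodic \<open>c\<close>\<close>

text \<open>Univalence on arbitrarily large discs bounds the derivative by distortion, so by
  Liouville it is a constant \<open>\<alpha>\<close>. If its modulus were below 1, \<open>f\<close>
  would be a contraction that attracts \<open>c\<close>.\<close>

lemma (in orbit_in_domain) orb_mult_lower_bound_entire:
  assumes notAB: "c \<notin> AB V f"
    and big: "\<And>R. \<exists>t>R. ball c t \<subseteq> V \<and> inj_on f (ball c t)"
  shows "1 \<le> orb_mult 0 n"
proof -
  have V: "V = UNIV"
  proof -
    have "z \<in> V" for z
      using big[of "dist c z"] by auto
    then show ?thesis
      by auto
  qed
  have bd: "cmod (deriv f z) \<le> 2 ^ koebe_exponent * cmod (deriv f c)" for z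
  proof -
    obtain t where t: "2 * dist c z + 1 < t" "inj_on f (ball c t)"
      using big by blast
    show ?thesis
    proof (rule univalent_deriv_distortion(2))
      show "f holomorphic_on ball c t"
        using holf V holomorphic_on_subset by blast
      have "0 < t - dist c z"
        using t(1) zero_le_dist[of c z] by linarith
      then show "t / (t - dist c z) \<le> 2"
        using t(1) by (simp add: field_simps)
      show "z \<in> ball c t"
        using \<open>0 < t - dist c z\<close> by simp
    qed fact
  qed
  have "deriv f holomorphic_on UNIV"
    using holf V holomorphic_deriv by blast
  moreover have "bounded (range (deriv f))"
    using bd unfolding bounded_iff by blast
  ultimately have "deriv f constant_on UNIV"
    by (rule Liouville_theorem)
  then obtain \<alpha> where \<alpha>: "\<And>z. deriv f z = \<alpha>"
    unfolding constant_on_def by auto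
  have "1 \<le> cmod \<alpha>"
  proof (rule ccontr)
    assume "\<not> 1 \<le> cmod \<alpha>"
    then have \<alpha>1: "cmod \<alpha> < 1" by simp
    have lip: "dist (f x) (f y) \<le> cmod \<alpha> * dist x y" for x y
      unfolding dist_norm
    proof (rule field_differentiable_bound[where S = UNIV and f' = "\<lambda>_. \<alpha>"])
      show "(f has_field_derivative \<alpha>) (at z within UNIV)" for z
        using holomorphic_derivI[OF holf openV, of z] V \<alpha> by simp
    qed auto
    define e where "e = dist c (f c)"
    define t where "t = e / (1 - cmod \<alpha>) + 1"
    have "0 \<le> e / (1 - cmod \<alpha>)"
      using \<alpha>1 by (simp add: e_def)
    then have t: "e / (1 - cmod \<alpha>) < t" "0 < t"
      by (simp_all add: t_def)
    define s where "s = e + cmod \<alpha> * t"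
    have "s < t"
      using t \<alpha>1 by (simp add: s_def field_simps)
    \<comment> \<open>The image is only known to lie in the closed disc of radius \<open>s\<close>;
      the midpoint gives an open disc still smaller than \<open>t\<close>.\<close>
    moreover have "maps V f 1 (ball c t) (ball c ((s + t) / 2))"
      unfolding maps_def
    proof (intro conjI allI impI)
      show "(f ^^ 1) ` ball c t \<subseteq> ball c ((s + t) / 2)"
      proof safe
        fix y assume "y \<in> ball c t"
        then have "cmod \<alpha> * dist c y \<le> cmod \<alpha> * t"
          by (intro mult_left_mono) auto
        then have "dist c (f y) \<le> s"
          using dist_triangle[of c "f y" "f c"] lip[of c y] by (simp add: s_def e_def)
        then show "(f ^^ 1) y \<in> ball c ((s + t) / 2)"
          using \<open>s < t\<close> by simp
      qed
    qed (simp add: V)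
    ultimately have "c \<in> AB V f"
      using orbit_attracted[of 1 "(s + t) / 2" t c 0] t by simp
    then show False
      using notAB by simp
  qed
  then show ?thesis
    by (simp add: orb_mult_def \<alpha> one_le_power)
qed

text \<open>The cycle of \<open>c\<close> is not attracting, so each full period multiplies the
  derivative by at least 1, and the minimum over one period is a lower bound. It is positive, as a
  vanishing factor would make the multiplier 0.\<close>

lemma (in orbit_in_domain) orb_mult_lower_bound_periodic:
  assumes notAB: "c \<notin> AB V f" and m: "1 \<le> m" "orb m = c"
  obtains C where "0 < C" "\<And>n. C \<le> orb_mult 0 n"
proof -
  have cyc: "1 \<le> orb_mult 0 m"
  proof (rule ccontr)
    assume "\<not> 1 \<le> orb_mult 0 m"
    moreover have "cmod (deriv (f ^^ m) c) = orb_mult 0 m"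
      using funpow_orb_has_derivative[of m 0] by (metis DERIV_imp_deriv add_0 funpow_0)
    ultimately have "attracting_periodic V f c m"
      using m orbV by (simp add: attracting_periodic_def)
    moreover have "orb (n * m) = c" for n
      using m(2) by (induction n) (simp_all add: funpow_add)
    then have "(\<lambda>n. orb (n * m)) \<longlonglongrightarrow> (f ^^ 0) c"
      by simp
    moreover have "0 < m"
      using m(1) by simp
    ultimately have "\<exists>p k. attracting_periodic V f p k \<and> (\<exists>j<k. (\<lambda>n. orb (n * k)) \<longlonglongrightarrow> (f ^^ j) p)"
      by blast
    then have "c \<in> AB V f"
      unfolding AB_def using orbV orbV[of 0] by simp
    then show False
      using notAB by simp
  qed
  define C where "C = Min (orb_mult 0 ` {..<m})"
  have pos: "0 < orb_mult 0 n" if "n < m" for n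
  proof -
    have "0 \<le> orb_mult 0 n"
      unfolding orb_mult_def by (intro prod_nonneg) auto
    moreover have "orb_mult 0 n \<noteq> 0"
      using orb_mult_chain[of 0 n m] that cyc by auto
    ultimately show ?thesis by simp
  qed
  have Cle: "C \<le> orb_mult 0 n" for n
  proof (induction n rule: less_induct)
    case (less n)
    show ?case
    proof (cases "n < m")
      case False
      have "orb (j + m) = orb j" for j
        using m(2) by (simp add: funpow_add)
      then have "orb_mult m n = orb_mult 0 (n - m)"
        unfolding orb_mult_def using prod.shift_bounds_nat_ivl[of "\<lambda>j. cmod (deriv f (orb j))" 0 m "n - m"] False
        by simp
      moreover have "0 \<le> orb_mult 0 (n - m)"
        unfolding orb_mult_def by (intro prod_nonneg) auto
      ultimately have "orb_mult 0 (n - m) \<le> orb_mult 0 n"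
        using orb_mult_chain[of 0 m n] False cyc mult_right_mono[of 1 "orb_mult 0 m" "orb_mult 0 (n - m)"] by simp
      then show ?thesis
        using less[of "n - m"] False m(1) by simp
    qed (simp add: C_def)
  qed
  moreover have "0 < C"
    unfolding C_def using pos m(1) by (subst Min_gr_iff) (auto simp: lessThan_empty_iff)
  ultimately show ?thesis
    using that by blast
qed

section \<open>Choice of the constants and conclusion\<close>

text \<open>If univalent discs around \<open>c\<close> have bounded radius, the constants are chosen
  in the order \<open>M\<close>, \<open>G\<close>, \<open>N\<close>, \<open>\<delta>\<close>,
  \<open>\<epsilon>\<close>, \<open>R\<close>, \<open>L\<close>, each from the earlier ones;
  otherwise the affine case applies.\<close>

lemma (in nonperiodic_orbit) orb_mult_lower_bound_exp:
  assumes notAB: "c \<notin> AB V f" and \<eta>: "0 < \<eta>"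
  obtains C where "0 < C" "\<And>n. C * exp (- 2 * \<eta> * real n) \<le> orb_mult 0 n"
proof (cases "\<exists>R. \<forall>t. ball c t \<subseteq> V \<and> inj_on f (ball c t) \<longrightarrow> t \<le> R")
  case False
  then have "1 \<le> orb_mult 0 n" for n
    using orb_mult_lower_bound_entire[OF notAB] by (metis not_le)
  moreover have "exp (- 2 * \<eta> * real n) \<le> 1" for n
    using \<eta> by simp
  ultimately have "1 * exp (- 2 * \<eta> * real n) \<le> orb_mult 0 n" for n
    by (metis mult_1 order_trans)
  then show ?thesis
    using that zero_less_one by blast
next
  case True
  then obtain R0 where R0: "\<And>t. ball c t \<subseteq> V \<Longrightarrow> inj_on f (ball c t) \<Longrightarrow> t \<le> R0"
    by blast
  obtain M where M: "\<And>m. M \<le> m \<Longrightarrow> 8 * loss m \<le> exp (\<eta> * real m)"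
    using loss_le_exp[OF \<eta>] by metis
  define G where "G = Max (insert 1 ((\<lambda>m. 8 * loss m) ` {..<M}))"
  have G: "1 \<le> G" "m < M \<Longrightarrow> 8 * loss m \<le> G" for m
    by (auto simp: G_def)
  obtain N where N: "\<And>m. N \<le> m \<Longrightarrow> 8 * G * loss m \<le> exp (\<eta> * real m)"
    using loss_le_exp[OF \<eta>] by metis
  define \<delta> where "\<delta> = Min (insert 1 ((\<lambda>m. dist (orb m) c / 2) ` {1..<N}))"
  have \<delta>: "0 < \<delta>" "1 \<le> m \<Longrightarrow> m < N \<Longrightarrow> 2 * \<delta> \<le> dist (orb m) c" for m
  proof -
    show "0 < \<delta>"
      using nonper by (auto simp: \<delta>_def Min_gr_iff)
    assume "1 \<le> m" "m < N"
    then have "\<delta> \<le> dist (orb m) c / 2"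
      unfolding \<delta>_def by (intro Min_le) auto
    then show "2 * \<delta> \<le> dist (orb m) c"
      by simp
  qed
  define B where "B m = (4 * (real m)\<^sup>2) ^ (2 * koebe_exponent) / orb_mult 0 m" for m
  have B: "0 < B m" if "1 \<le> m" for m
    using that orb_mult_pos[of 0 m] by (simp add: B_def)
  \<comment> \<open>The 2 in the denominator makes the closeness estimate strict.\<close>
  define \<epsilon> where "\<epsilon> = Min (insert (min \<rho> \<delta>) ((\<lambda>m. \<delta> / (2 * B m)) ` {1..<M}))"
  have "\<epsilon> \<le> min \<rho> \<delta>"
    unfolding \<epsilon>_def by (intro Min_le) auto
  then have \<epsilon>: "0 < \<epsilon>" "\<epsilon> \<le> \<rho>" "\<epsilon> \<le> \<delta>"
    using \<rho>0 \<delta>(1) B by (auto simp: \<epsilon>_def Min_gr_iff)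
  have near: "\<epsilon> * (4 * (real m)\<^sup>2) ^ (2 * koebe_exponent) / orb_mult 0 m < \<delta>" if m: "1 \<le> m" "m < M" for m
  proof -
    have "\<epsilon> \<le> \<delta> / (2 * B m)"
      unfolding \<epsilon>_def using m by (intro Min_le) auto
    then have "\<epsilon> * B m \<le> \<delta> / 2"
      using B[OF m(1)] by (simp add: field_simps)
    then have "\<epsilon> * B m < \<delta>"
      using \<delta>(1) by simp
    then show ?thesis
      by (simp add: B_def)
  qed
  interpret weighted_orbit V f c V' \<rho> \<eta> \<delta> \<epsilon> G M N
    using \<eta> G \<epsilon> M N \<delta>(2) near by unfold_locales auto
  \<comment> \<open>The maximum ensures \<open>\<epsilon> / R \<le> 1\<close>.\<close>
  define R where "R = max R0 \<epsilon>"
  obtain L :: nat where "R / \<epsilon> / \<eta> \<le> real L"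
    using real_arch_simple by blast
  then have "R / \<epsilon> \<le> \<eta> * real L"
    using \<eta> by (simp only: pos_divide_le_eq mult.commute)
  then have "R / \<epsilon> \<le> exp (\<eta> * real L)"
    using exp_ge_add_one_self[of "\<eta> * real L"] by linarith
  then have "1 / G * (\<epsilon> / R) ^ L * exp (- 2 * \<eta> * real n) \<le> orb_mult 0 n" for n
    using notAB R0 by (intro orb_mult_lower_bound) (auto simp: R_def intro: max.coboundedI1)
  moreover have "0 < 1 / G * (\<epsilon> / R) ^ L"
    using G(1) \<epsilon>(1) by (simp add: R_def)
  ultimately show ?thesis
    using that by blast
qed

theorem theorem1p3:
  fixes V V' :: "complex set" and f :: "complex \<Rightarrow> complex" and c :: complex
  assumes "open V" and "open V'" and "V \<subseteq> V'"
    and "U_class V V' f"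
    and "U_point V V' f c"
    and "c \<notin> AB V f"
  shows "chi_minus f c \<ge> 0"
proof -
  obtain \<rho> where \<rho>: "\<rho> > 0" "covering_space (V - {z \<in> V. f z = c}) f (V' - {c})"
    "\<And>n. (f ^^ n) c \<in> V" "\<And>n. ball ((f ^^ n) c) \<rho> \<subseteq> V'"
    using assms(5) unfolding U_point_def by blast
  interpret orbit_in_domain V f c
    using assms(1,4) \<rho>(3) by unfold_locales (auto simp: U_class_def)
  have lower: "\<exists>C>0. \<forall>n. C * exp (- 2 * \<eta> * real n) \<le> orb_mult 0 n" if "0 < \<eta>" for \<eta>
  proof (cases "\<exists>m\<ge>1. orb m = c")
    case True
    then obtain C where "0 < C" "\<And>n. C \<le> orb_mult 0 n"
      using orb_mult_lower_bound_periodic[OF assms(6)] by metis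
    moreover have "C * exp (- 2 * \<eta> * real n) \<le> C" for n
      using \<open>0 < C\<close> that by simp
    ultimately show ?thesis
      using order_trans by blast
  next
    case False
    interpret nonperiodic_orbit V f c V' \<rho>
      using assms(2,3) \<rho> False by unfold_locales auto
    show ?thesis
      using orb_mult_lower_bound_exp[OF assms(6) that] by metis
  qed
  have deriv_orb: "cmod (deriv (f ^^ n) c) = orb_mult 0 n" for n
    using funpow_orb_has_derivative[of n 0] by (metis DERIV_imp_deriv add_0 funpow_0)
  have "0 \<le> chi_minus f c + ereal \<eta>" if "0 < \<eta>" for \<eta>
  proof -
    \<comment> \<open>The lower bound is used with decay rate \<open>2 * (\<eta> / 3)\<close>; the
      remaining third of \<open>\<eta>\<close> absorbs \<open>ln C / real n\<close>, which tends to
      0.\<close>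
    obtain C where C: "0 < C" "\<And>n. C * exp (- 2 * (\<eta> / 3) * real n) \<le> orb_mult 0 n"
      using lower[of "\<eta> / 3"] \<open>0 < \<eta>\<close> by auto
    have "(\<lambda>n. ln C / real n) \<longlonglongrightarrow> 0"
      by (rule lim_const_over_n)
    then have "\<forall>\<^sub>F n in sequentially. - \<eta> / 3 < ln C / real n"
      by (rule order_tendstoD) (use \<open>0 < \<eta>\<close> in simp)
    then have "\<forall>\<^sub>F n in sequentially. ereal (- \<eta>) \<le> ereal (1 / real n) * log_abs (deriv (f ^^ n) c)"
      using eventually_gt_at_top[of 0]
    proof eventually_elim
      case (elim n)
      have pos: "0 < C * exp (- 2 * (\<eta> / 3) * real n)"
        using C(1) by simp
      then have "ln (C * exp (- 2 * (\<eta> / 3) * real n)) \<le> ln (orb_mult 0 n)"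
        using C(2)[of n] by (intro ln_mono) auto
      then have "ln C - 2 * (\<eta> / 3) * real n \<le> ln (orb_mult 0 n)"
        using C(1) by (simp add: ln_mult)
      then have "(ln C - 2 * (\<eta> / 3) * real n) / real n \<le> ln (orb_mult 0 n) / real n"
        by (intro divide_right_mono) auto
      moreover have "(ln C - 2 * (\<eta> / 3) * real n) / real n = ln C / real n - 2 * \<eta> / 3"
        using elim(2) by (simp add: diff_divide_distrib)
      ultimately have "- \<eta> \<le> ln (orb_mult 0 n) / real n"
        using elim(1) by linarith
      \<comment> \<open>Excludes the value \<open>- \<infinity>\<close> of
        \<open>log_abs\<close>.\<close>
      moreover have "0 < orb_mult 0 n"
        using pos C(2)[of n] by linarith
      ultimately show ?case
        using deriv_orb[of n] by (auto simp: log_abs_def)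
    qed
    then have "ereal (- \<eta>) \<le> chi_minus f c"
      unfolding chi_minus_def by (rule Liminf_bounded)
    then have "ereal (- \<eta>) + ereal \<eta> \<le> chi_minus f c + ereal \<eta>"
      by (rule add_right_mono)
    then show ?thesis
      by (simp add: zero_ereal_def)
  qed
  then show ?thesis
    by (rule ereal_le_epsilon2)
qed

end
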